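(* Suppose there is $\theta_\times\in(0,1)$ with $y_A(\theta_\times)=y_P(\theta_\times)$ (so $b(\theta_\times)=0$, and $\theta_\times$ is the only zero of $b$). Let $\Theta_1=[0,\theta_\times]$, $\Theta_2=[\theta_\times,1]$, let $(\mu_i^*,\tau_i^* )$ be the regional mean and variance functions on $\Theta_i$ and $w_i$ the regional worst losses defined in the context, and $\bar w=\max\{w_1,w_2\}$. Let $m^*:\Theta\to\Delta(\mathcal A)$ be a Borel probability kernel whose mean and variance functions $(\mu^*,\tau^* )$ are as follows. If the bias $b$ is increasing, $$(\mu^*(\theta),\tau^*(\theta))=\begin{cases}(\mu_1^*(\theta),\tau_1^*(\theta)),&0\le\theta\le\theta_\times,\\(\mu_2^*(\theta),\tau_2^*(\theta)),&\theta_\times<\theta\le1;\end{cases}$$ if the bias $b$ is decreasing, $$(\mu^*(\theta),\tau^*(\theta))=\begin{cases}(\mu_1^*(\theta),\tau_1^*(\theta)+\bar w-w_1),&0\le\theta\le\theta_\times,\\(\mu_2^*(\theta),\tau_2^*(\theta)+\bar w-w_2),&\theta_\times<\theta\le1.\end{cases}$$ Then $m^*$ is robustly optimal, i.e. $m^*\in\mathcal M$ and $$\inf_{F\in\mathcal F(\Theta)}V(m^*,F)=\sup_{m\in\mathcal M}\ \inf_{F\in\mathcal F(\Theta)}V(m,F).$$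
   Context: **Model.** $\Theta=[0,1]$; $\mathcal A\subset\mathbb R$ is a compact interval; $y_P,y_A:\Theta\to\mathcal A$ are continuously differentiable and strictly increasing. The bias is $b(\theta):=y_A(\theta)-y_P(\theta)$; it is assumed to be either weakly increasing on $\Theta$ or weakly decreasing on $\Theta$ (called "increasing" resp. "decreasing" bias), and there is at most one $\theta\in\Theta$ with $b(\theta)=0$. $\mathcal F(\Theta)$ is the set of CDFs of Borel probability distributions on $\Theta$. A mechanism is a Borel probability kernel $m:\Theta\to\Delta(\mathcal A)$, where $\Delta(\mathcal A)$ is the set of Borel probability distributions on $\mathcal A$; its mean and variance functions are $\mu_m(\hat\theta)=\int a\,dm(a\mid\hat\theta)$ and $\tau_m(\hat\theta)=\int (a-\mu_m(\hat\theta))^2\,dm(a\mid\hat\theta)$. For $j\in\{P,A\}$, $U_{j,m}(\theta,\hat\theta):=-\int (a-y_j(\theta))^2\,dm(a\mid\hat\theta)=-\tau_m(\hat\theta)-(\mu_m(\hat\theta)-y_j(\theta))^2$ and $U_{j,m}(\theta):=U_{j,m}(\theta,\theta)$. $\mathcal M$ is the set of incentive-compatible mechanisms, i.e. those with $U_{A,m}(\theta,\theta)\ge U_{A,m}(\theta,\hat\theta)$ for all $\theta,\hat\theta\in\Theta$. For $m\in\mathcal M$, $F\in\mathcal F(\Theta)$: $V(m,F):=\int_\Theta U_{P,m}(\theta)\,dF(\theta)$. **Positive-bias construction on an interval $[\alpha,\beta]$.** Let $z_P,z_A:[\alpha,\beta]\to\mathbb R$ be $C^1$, strictly increasing, with $c:=z_A-z_P\ge0$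 monotone and having at most one zero, and $z_A(\alpha)<z_P(\beta)$. Put $\bar\theta:=z_A^{-1}(z_P(\beta))\in(\alpha,\beta]$ and, for $\theta\in[\alpha,\bar\theta]$ with $c(\theta)>0$, $$d(\theta):=\frac{c(\bar\theta)}2\exp\Bigl(-\int_\theta^{\bar\theta}\frac{z_P'(t)}{c(t)}dt\Bigr)+\int_\theta^{\bar\theta}z_P'(t)\exp\Bigl(-\int_\theta^t\frac{z_P'(s)}{c(s)}ds\Bigr)dt .$$ If $c(\beta)=0$ (then $\bar\theta=\beta$), integrals with upper endpoint $\beta$ are improper (one-sided limits), $\exp(-\infty)=0$, and $d(\beta):=0$. Put $\underline\theta:=\inf\{\theta\in[\alpha,\bar\theta]:c(\theta)>0,\ d(\theta)\le c(\theta)\}$. The constructed mean and variance functions on $[\alpha,\beta]$ are: $(z_A(\theta),\,0)$ for $\alpha\le\theta<\underline\theta$; $(z_P(\theta)+d(\theta),\ d(\underline\theta)^2-d(\theta)^2)$ for $\underline\theta\le\theta\le\bar\theta$; $\bigl(\frac{z_P(\bar\theta)+z_P(\beta)}2,\ d(\underline\theta)^2-\frac{c(\bar\theta)^2}4\bigr)$ for $\bar\theta<\theta\le\beta$. The associated worst loss is $d(\underline\theta)^2$. **Regional mechanisms.** Write $\Theta_i=[\alpha,\beta]$. If $b\ge0$ on $\Theta_i$, then $(\mu_i^*,\tau_i^* )$ and $w_i$ are the mean/variance functions and worst loss given by the positive-bias construction on $[\alpha,\beta]$ applied to $(z_P,z_A)=(y_P,y_A)|_{\Theta_i}$. If $b\le0$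 on $\Theta_i$, put $\kappa:=y_P(\alpha)+y_P(\beta)$, apply the positive-bias construction on $[\alpha,\beta]$ to the reflected functions $z_j(\theta):=\kappa-y_j(\alpha+\beta-\theta)$, $j\in\{P,A\}$, obtaining mean and variance functions $(\mu_R,\tau_R)$ and worst loss $w_i$, and set $\mu_i^*(\theta):=\kappa-\mu_R(\alpha+\beta-\theta)$, $\tau_i^*(\theta):=\tau_R(\alpha+\beta-\theta)$. (With increasing bias, $b\le0$ on $\Theta_1$ and $b\ge0$ on $\Theta_2$; with decreasing bias the signs are reversed.) The action interval $\mathcal A$ is assumed large enough that a kernel into $\Delta(\mathcal A)$ with mean $\mu^*$ and variance $\tau^*$ exists (writing $\mathcal A=[\alpha_0,\beta_0]$: $\tau^*(\theta)\le(\mu^*(\theta)-\alpha_0)(\beta_0-\mu^*(\theta))$ for all $\theta$). *)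

theory Defs
  imports "HOL-Probability.Probability"
begin

text \<open>
  Continuous differentiability on a compact interval, with one-sided derivatives at the
  endpoints. (The library's \<^const>\<open>C1_differentiable_on\<close> asks for two-sided derivatives
  there, which would constrain the functions outside the interval.)
\<close>

definition C1_on_Icc :: "real \<Rightarrow> real \<Rightarrow> (real \<Rightarrow> real) \<Rightarrow> bool" where
  "C1_on_Icc \<alpha> \<beta> f \<longleftrightarrow>
     (\<exists>f'. (\<forall>x\<in>{\<alpha>..\<beta>}. (f has_real_derivative f' x) (at x within {\<alpha>..\<beta>})) \<and>
           continuous_on {\<alpha>..\<beta>} f')"

abbreviation Types :: "real set" where
  "Types \<equiv> {0..1}"

definition kernels :: "real set \<Rightarrow> (real \<Rightarrow> real measure) set" where
  "kernels A = restrict_space borel Types \<rightarrow>\<^sub>M prob_algebra (restrict_space borel A)"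

definition mech_mean :: "(real \<Rightarrow> real measure) \<Rightarrow> real \<Rightarrow> real" where
  "mech_mean m r = (LINT a|m r. a)"

definition mech_var :: "(real \<Rightarrow> real measure) \<Rightarrow> real \<Rightarrow> real" where
  "mech_var m r = (LINT a|m r. (a - mech_mean m r)\<^sup>2)"

text \<open>\<open>payoff y m \<theta> r\<close>: payoff of a player with ideal-action function \<open>y\<close> when the true type
  is \<open>\<theta>\<close> and the report is \<open>r\<close>.\<close>

definition payoff :: "(real \<Rightarrow> real) \<Rightarrow> (real \<Rightarrow> real measure) \<Rightarrow> real \<Rightarrow> real \<Rightarrow> real" where
  "payoff y m \<theta> r = - (LINT a|m r. (a - y \<theta>)\<^sup>2)"

definition IC_mechanisms :: "real set \<Rightarrow> (real \<Rightarrow> real) \<Rightarrow> (real \<Rightarrow> real measure) set" where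
  "IC_mechanisms A y\<^sub>A =
     {m \<in> kernels A. \<forall>\<theta>\<in>Types. \<forall>r\<in>Types. payoff y\<^sub>A m \<theta> \<theta> \<ge> payoff y\<^sub>A m \<theta> r}"

definition type_CDFs :: "(real \<Rightarrow> real) set" where
  "type_CDFs = {cdf \<nu> | \<nu>. real_distribution \<nu> \<and> measure \<nu> Types = 1}"

definition mech_value :: "(real \<Rightarrow> real) \<Rightarrow> (real \<Rightarrow> real measure) \<Rightarrow> (real \<Rightarrow> real) \<Rightarrow> real" where
  "mech_value y\<^sub>P m F = (LINT \<theta>:Types|interval_measure F. payoff y\<^sub>P m \<theta> \<theta>)"

text \<open>
  When the values of \<open>y\<^sub>P\<close> lie in the compact action set, all payoffs of kernels are bounded,
  so the infima and the supremum below are taken over nonempty bounded sets of reals.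
\<close>

definition robustly_optimal ::
    "real set \<Rightarrow> (real \<Rightarrow> real) \<Rightarrow> (real \<Rightarrow> real) \<Rightarrow> (real \<Rightarrow> real measure) \<Rightarrow> bool" where
  "robustly_optimal A y\<^sub>P y\<^sub>A m \<longleftrightarrow>
     m \<in> IC_mechanisms A y\<^sub>A \<and>
     (INF F\<in>type_CDFs. mech_value y\<^sub>P m F) =
       (SUP m'\<in>IC_mechanisms A y\<^sub>A. INF F\<in>type_CDFs. mech_value y\<^sub>P m' F)"

definition theta_bar :: "(real \<Rightarrow> real) \<Rightarrow> (real \<Rightarrow> real) \<Rightarrow> real \<Rightarrow> real \<Rightarrow> real" where
  "theta_bar z\<^sub>P z\<^sub>A \<alpha> \<beta> = the_inv_into {\<alpha>..\<beta>} z\<^sub>A (z\<^sub>P \<beta>)"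

text \<open>
  \<open>integral\<close> is the Henstock--Kurzweil integral, which contains the improper (one-sided limit)
  integrals that occur when \<open>c(\<beta>) = 0\<close> (and then \<open>theta_bar = \<beta>\<close>). In that case the integral
  in the first summand may diverge, where the convention \<open>exp(-\<infinity>) = 0\<close> is not
  expressible by a real-valued integral; but its factor \<open>c(\<beta>)/2\<close> is \<open>0\<close>, so the summand is
  \<open>0\<close> anyway. In the second summand only the single point \<open>t = \<beta>\<close> is affected. At
  \<open>\<theta> = \<beta>\<close> both summands vanish, which gives \<open>d(\<beta>) = 0\<close>.
  Only arguments \<open>\<theta> \<le> theta_bar\<close> with \<open>c(\<theta>) > 0\<close>, and \<open>\<theta> = \<beta>\<close>, are meaningful.
\<close>

definition d_fun :: "(real \<Rightarrow> real) \<Rightarrow> (real \<Rightarrow> real) \<Rightarrow> real \<Rightarrow> real \<Rightarrow> real \<Rightarrow> real" where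
  "d_fun z\<^sub>P z\<^sub>A \<alpha> \<beta> \<theta> =
     (let c = (\<lambda>t. z\<^sub>A t - z\<^sub>P t);
          z' = (\<lambda>t. vector_derivative z\<^sub>P (at t within {\<alpha>..\<beta>}));
          \<theta>b = theta_bar z\<^sub>P z\<^sub>A \<alpha> \<beta>
      in c \<theta>b / 2 * exp (- integral {\<theta>..\<theta>b} (\<lambda>t. z' t / c t)) +
         integral {\<theta>..\<theta>b} (\<lambda>t. z' t * exp (- integral {\<theta>..t} (\<lambda>s. z' s / c s))))"

definition theta_low :: "(real \<Rightarrow> real) \<Rightarrow> (real \<Rightarrow> real) \<Rightarrow> real \<Rightarrow> real \<Rightarrow> real" where
  "theta_low z\<^sub>P z\<^sub>A \<alpha> \<beta> =
     Inf {\<theta> \<in> {\<alpha>..theta_bar z\<^sub>P z\<^sub>A \<alpha> \<beta>}.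
            z\<^sub>A \<theta> - z\<^sub>P \<theta> > 0 \<and> d_fun z\<^sub>P z\<^sub>A \<alpha> \<beta> \<theta> \<le> z\<^sub>A \<theta> - z\<^sub>P \<theta>}"

definition pos_loss :: "(real \<Rightarrow> real) \<Rightarrow> (real \<Rightarrow> real) \<Rightarrow> real \<Rightarrow> real \<Rightarrow> real" where
  "pos_loss z\<^sub>P z\<^sub>A \<alpha> \<beta> = (d_fun z\<^sub>P z\<^sub>A \<alpha> \<beta> (theta_low z\<^sub>P z\<^sub>A \<alpha> \<beta>))\<^sup>2"

definition pos_mean :: "(real \<Rightarrow> real) \<Rightarrow> (real \<Rightarrow> real) \<Rightarrow> real \<Rightarrow> real \<Rightarrow> real \<Rightarrow> real" where
  "pos_mean z\<^sub>P z\<^sub>A \<alpha> \<beta> \<theta> =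
     (let \<theta>b = theta_bar z\<^sub>P z\<^sub>A \<alpha> \<beta>
      in if \<theta> < theta_low z\<^sub>P z\<^sub>A \<alpha> \<beta> then z\<^sub>A \<theta>
         else if \<theta> \<le> \<theta>b then z\<^sub>P \<theta> + d_fun z\<^sub>P z\<^sub>A \<alpha> \<beta> \<theta>
         else (z\<^sub>P \<theta>b + z\<^sub>P \<beta>) / 2)"

definition pos_var :: "(real \<Rightarrow> real) \<Rightarrow> (real \<Rightarrow> real) \<Rightarrow> real \<Rightarrow> real \<Rightarrow> real \<Rightarrow> real" where
  "pos_var z\<^sub>P z\<^sub>A \<alpha> \<beta> \<theta> =
     (let \<theta>b = theta_bar z\<^sub>P z\<^sub>A \<alpha> \<beta>;
          dl = d_fun z\<^sub>P z\<^sub>A \<alpha> \<beta> (theta_low z\<^sub>P z\<^sub>A \<alpha> \<beta>)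
      in if \<theta> < theta_low z\<^sub>P z\<^sub>A \<alpha> \<beta> then 0
         else if \<theta> \<le> \<theta>b then dl\<^sup>2 - (d_fun z\<^sub>P z\<^sub>A \<alpha> \<beta> \<theta>)\<^sup>2
         else dl\<^sup>2 - (z\<^sub>A \<theta>b - z\<^sub>P \<theta>b)\<^sup>2 / 4)"

definition reflect :: "real \<Rightarrow> real \<Rightarrow> real \<Rightarrow> (real \<Rightarrow> real) \<Rightarrow> real \<Rightarrow> real" where
  "reflect \<kappa> \<alpha> \<beta> y \<theta> = \<kappa> - y (\<alpha> + \<beta> - \<theta>)"

definition nonneg_bias :: "(real \<Rightarrow> real) \<Rightarrow> (real \<Rightarrow> real) \<Rightarrow> real \<Rightarrow> real \<Rightarrow> bool" where
  "nonneg_bias y\<^sub>P y\<^sub>A \<alpha> \<beta> \<longleftrightarrow> (\<forall>\<theta>\<in>{\<alpha>..\<beta>}. y\<^sub>A \<theta> - y\<^sub>P \<theta> \<ge> 0)"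

text \<open>The else-branches below are for bias \<open>\<le> 0\<close> on \<open>[\<alpha>, \<beta>]\<close>. A bias that is monotone with
  at most one zero cannot satisfy both sign conditions on a nondegenerate interval.\<close>

definition reg_mean :: "(real \<Rightarrow> real) \<Rightarrow> (real \<Rightarrow> real) \<Rightarrow> real \<Rightarrow> real \<Rightarrow> real \<Rightarrow> real" where
  "reg_mean y\<^sub>P y\<^sub>A \<alpha> \<beta> \<theta> =
     (if nonneg_bias y\<^sub>P y\<^sub>A \<alpha> \<beta> then pos_mean y\<^sub>P y\<^sub>A \<alpha> \<beta> \<theta>
      else let \<kappa> = y\<^sub>P \<alpha> + y\<^sub>P \<beta>
           in \<kappa> - pos_mean (reflect \<kappa> \<alpha> \<beta> y\<^sub>P) (reflect \<kappa> \<alpha> \<beta> y\<^sub>A) \<alpha> \<beta> (\<alpha> + \<beta> - \<theta>))"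

definition reg_var :: "(real \<Rightarrow> real) \<Rightarrow> (real \<Rightarrow> real) \<Rightarrow> real \<Rightarrow> real \<Rightarrow> real \<Rightarrow> real" where
  "reg_var y\<^sub>P y\<^sub>A \<alpha> \<beta> \<theta> =
     (if nonneg_bias y\<^sub>P y\<^sub>A \<alpha> \<beta> then pos_var y\<^sub>P y\<^sub>A \<alpha> \<beta> \<theta>
      else let \<kappa> = y\<^sub>P \<alpha> + y\<^sub>P \<beta>
           in pos_var (reflect \<kappa> \<alpha> \<beta> y\<^sub>P) (reflect \<kappa> \<alpha> \<beta> y\<^sub>A) \<alpha> \<beta> (\<alpha> + \<beta> - \<theta>))"

definition reg_loss :: "(real \<Rightarrow> real) \<Rightarrow> (real \<Rightarrow> real) \<Rightarrow> real \<Rightarrow> real \<Rightarrow> real" where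
  "reg_loss y\<^sub>P y\<^sub>A \<alpha> \<beta> =
     (if nonneg_bias y\<^sub>P y\<^sub>A \<alpha> \<beta> then pos_loss y\<^sub>P y\<^sub>A \<alpha> \<beta>
      else let \<kappa> = y\<^sub>P \<alpha> + y\<^sub>P \<beta>
           in pos_loss (reflect \<kappa> \<alpha> \<beta> y\<^sub>P) (reflect \<kappa> \<alpha> \<beta> y\<^sub>A) \<alpha> \<beta>)"

definition star_mean :: "(real \<Rightarrow> real) \<Rightarrow> (real \<Rightarrow> real) \<Rightarrow> real \<Rightarrow> real \<Rightarrow> real" where
  "star_mean y\<^sub>P y\<^sub>A x \<theta> = (if \<theta> \<le> x then reg_mean y\<^sub>P y\<^sub>A 0 x \<theta> else reg_mean y\<^sub>P y\<^sub>A x 1 \<theta>)"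

definition star_var_inc :: "(real \<Rightarrow> real) \<Rightarrow> (real \<Rightarrow> real) \<Rightarrow> real \<Rightarrow> real \<Rightarrow> real" where
  "star_var_inc y\<^sub>P y\<^sub>A x \<theta> = (if \<theta> \<le> x then reg_var y\<^sub>P y\<^sub>A 0 x \<theta> else reg_var y\<^sub>P y\<^sub>A x 1 \<theta>)"

definition star_var_dec :: "(real \<Rightarrow> real) \<Rightarrow> (real \<Rightarrow> real) \<Rightarrow> real \<Rightarrow> real \<Rightarrow> real" where
  "star_var_dec y\<^sub>P y\<^sub>A x \<theta> =
     (let w1 = reg_loss y\<^sub>P y\<^sub>A 0 x; w2 = reg_loss y\<^sub>P y\<^sub>A x 1; w = max w1 w2
      in if \<theta> \<le> x then reg_var y\<^sub>P y\<^sub>A 0 x \<theta> + w - w1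
         else reg_var y\<^sub>P y\<^sub>A x 1 \<theta> + w - w2)"

text \<open>A bias with exactly one zero in \<^const>\<open>Types\<close> cannot be both increasing and decreasing.\<close>

definition star_var :: "(real \<Rightarrow> real) \<Rightarrow> (real \<Rightarrow> real) \<Rightarrow> real \<Rightarrow> real \<Rightarrow> real" where
  "star_var y\<^sub>P y\<^sub>A x =
     (if mono_on Types (\<lambda>\<theta>. y\<^sub>A \<theta> - y\<^sub>P \<theta>) then star_var_inc y\<^sub>P y\<^sub>A x
      else star_var_dec y\<^sub>P y\<^sub>A x)"

end

theory Submission
  imports Defs
begin

text \<open>
  Point masses belong to the principal's ambiguity set, so a mechanism is robustly optimal iff it
  minimises the worst loss \<open>\<tau> + (\<mu> - y\<^sub>P)\<^sup>2\<close> over types. On a region with bias \<open>c \<ge> 0\<close>, let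
  \<open>A\<close> be the agent's loss in an incentive compatible mechanism whose worst loss is at most \<open>K\<close>.
  Then \<open>D = (K - A + c\<^sup>2) / (2 * c)\<close> dominates \<open>\<mu> - z\<^sub>P\<close>, and the envelope inequality makes it a
  supersolution of \<open>D' = z\<^sub>P' * (D / c - 1)\<close>, the equation solved by \<open>d\<close>. Type \<open>\<theta>b\<close> may mimic
  type \<open>\<beta>\<close>, which gives \<open>D \<ge> d\<close> at \<open>\<theta>b\<close> and hence at \<open>theta_low\<close>, where \<open>d \<le> c\<close> turns it into
  \<open>K \<ge> d\<^sup>2\<close>. The two regional mechanisms agree at the crossing point, and incentive compatibility
  on two adjacent intervals implies it on their union.
\<close>

section \<open>Calculus on a compact interval\<close>

text \<open>Where \<open>d\<close> comes from: the pair \<open>(zP + d, K - d^2)\<close> costs the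
  principal the same \<open>K\<close> at every type, and the first-order condition for truthful
  reporting by the agent then leaves just one differential equation for \<open>d\<close>. Its value
  \<open>c \<theta>b / 2\<close> at \<open>\<theta>b\<close> is half the distance from
  \<open>zP \<theta>b\<close> to \<open>zP \<beta> = zA \<theta>b\<close>: pooling the remaining
  types at the midpoint keeps the principal's loss within that of the end types.

  Two obstacles shape the argument. A competing mechanism has mean and variance functions without
  any regularity, so \<open>D\<close> cannot be differentiated; the envelope inequality makes only
  the agent's loss continuous, and the comparison has to run through one-sided difference quotients.
  And \<open>c\<close> vanishes at the crossing point, where the equation is singular. With
  increasing bias the zero is at the end \<open>\<alpha>\<close> of the (possibly reflected) region,
  and \<open>theta_low\<close> stays away from it. With decreasing bias it is at
  \<open>\<beta>\<close>, where the flow starts, and every statement there is a limit.\<close>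

lemma strict_mono_on_deriv_nonneg:
  fixes f :: "real \<Rightarrow> real"
  assumes "a < b" "x \<in> {a..b}" "strict_mono_on {a..b} f"
    and "(f has_real_derivative D) (at x within {a..b})"
  shows "0 \<le> D"
proof (rule tendsto_lowerbound)
  show "((\<lambda>y. (f y - f x) / (y - x)) \<longlongrightarrow> D) (at x within {a..b})"
    using assms(4) by (simp add: has_field_derivative_iff)
  show "at x within {a..b} \<noteq> bot"
    using assms(1,2) by (simp add: trivial_limit_within islimpt_Icc)
  have "0 \<le> (f y - f x) / (y - x)" if "y \<in> {a..b}" "y \<noteq> x" for y
    using strict_mono_onD[OF assms(3), of x y] strict_mono_onD[OF assms(3), of y x] that assms(2)
    by (cases "x < y") (auto intro!: divide_nonneg_nonneg divide_nonpos_nonpos)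
  then show "\<forall>\<^sub>F y in at x within {a..b}. 0 \<le> (f y - f x) / (y - x)"
    by (auto simp: eventually_at_filter)
qed

text \<open>A Dini-derivative test for functions not known to be differentiable: an upper bound
  \<open>g\<close> on the left increments, depending on the point \<open>s\<close> and of order o(s
  - r), is enough. If \<open>f\<close> rose, a slightly tilted copy would first reach its final
  level at some \<open>s\<close>, but the bound puts it above that level just before
  \<open>s\<close>.\<close>

lemma antimono_if_left_difference_quotient_le:
  fixes f :: "real \<Rightarrow> real"
  assumes cont: "continuous_on {a..b} f" and "a \<le> b"
    and quot: "\<And>s. s \<in> {a<..b} \<Longrightarrow>
      \<exists>g. (\<forall>r\<in>{a..<s}. f s - f r \<le> g r) \<and> ((\<lambda>r. g r / (s - r)) \<longlongrightarrow> 0) (at_left s)"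
  shows "f b \<le> f a"
proof (rule ccontr)
  assume "\<not> f b \<le> f a"
  then have lt: "f a < f b" by simp
  with \<open>a \<le> b\<close> have ab: "a < b" by (cases "a = b") auto
  \<comment> \<open>Half the mean slope of \<open>f\<close>, so that \<open>h\<close> still rises by
    \<open>(f b - f a) / 2\<close> over the interval.\<close>
  define e where "e = (f b - f a) / 2 / (b - a)"
  have e: "e > 0" using lt ab by (simp add: e_def)
  define h where "h = (\<lambda>s. f s - e * (s - a))"
  have "e * (b - a) = (f b - f a) / 2"
    using ab by (intro nonzero_eq_divide_eq[THEN iffD1, OF _ e_def]) simp
  then have hb: "h a < h b" using lt by (simp add: h_def)
  have conth: "continuous_on {a..b} h" unfolding h_def by (intro continuous_intros cont)
  define T where "T = {s \<in> {a..b}. h b \<le> h s}"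
  have Teq: "T = {a..b} \<inter> h -` {h b..}" by (auto simp: T_def)
  then have T_sub: "T \<subseteq> {a..b}" by simp
  have "closed T" unfolding Teq
    using continuous_closed_preimage[OF conth, of "{h b..}"] by simp
  then have cT: "compact T"
    using bounded_subset[OF bounded_closed_interval[of a b] T_sub] by (simp add: compact_eq_bounded_closed)
  have "b \<in> T" using ab by (auto simp: T_def)
  \<comment> \<open>The first point at which \<open>h\<close> is at the level \<open>h b\<close>;
    any \<open>r < s\<close> with \<open>h s < h r\<close> contradicts this choice.\<close>
  then obtain s where s: "s \<in> T" "\<forall>r\<in>T. s \<le> r"
    using compact_attains_inf[OF cT] by auto
  have "s \<noteq> a" using s(1) hb by (auto simp: T_def)
  then have sI: "s \<in> {a<..b}" using s(1) by (auto simp: T_def)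
  obtain g where g: "\<And>r. r \<in> {a..<s} \<Longrightarrow> f s - f r \<le> g r"
    "((\<lambda>r. g r / (s - r)) \<longlongrightarrow> 0) (at_left s)"
    using quot[OF sI] by blast
  have "\<forall>\<^sub>F r in at_left s. g r / (s - r) < e"
    using order_tendstoD(2)[OF g(2) e] .
  moreover have "\<forall>\<^sub>F r in at_left s. r \<in> {a<..<s}"
    using eventually_at_leftI[of a s] sI by auto
  ultimately have "\<forall>\<^sub>F r in at_left s. g r / (s - r) < e \<and> r \<in> {a<..<s}"
    by (rule eventually_conj)
  then obtain r where r: "g r / (s - r) < e" "r \<in> {a<..<s}"
    using eventually_happens'[OF trivial_limit_at_left_real] by blast
  then have "g r < e * (s - r)" by (simp add: field_simps)
  with g(1)[of r] r have "h s < h r" by (simp add: h_def algebra_simps)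
  then have "r \<in> T" using s(1) r sI by (auto simp: T_def)
  with s(2) r show False by auto
qed

lemma continuous_on_Icc_le:
  fixes f g :: "real \<Rightarrow> real"
  assumes "a < b" "continuous_on {a..b} f" "continuous_on {a..b} g"
    and "\<And>x. x \<in> {a..<b} \<Longrightarrow> f x \<le> g x"
  shows "f b \<le> g b"
proof (rule tendsto_le)
  show "(g \<longlongrightarrow> g b) (at_left b)" "(f \<longlongrightarrow> f b) (at_left b)"
    using assms(1,2,3) by (auto dest: continuous_on_Icc_at_leftD)
  show "\<forall>\<^sub>F x in at_left b. f x \<le> g x"
    using eventually_at_leftI[of a b "\<lambda>x. f x \<le> g x"] assms by auto
qed simp

section \<open>Incentive compatibility in terms of means and variances\<close>

text \<open>Quadratic payoffs see a mechanism only through mean and variance, so incentive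
  compatibility is written for these, with losses instead of payoffs. The set \<open>S\<close> is a
  parameter because the condition is restricted to regions and glued back.\<close>

definition ic_on :: "(real \<Rightarrow> real) \<Rightarrow> (real \<Rightarrow> real) \<Rightarrow> (real \<Rightarrow> real) \<Rightarrow> real set \<Rightarrow> bool" where
  "ic_on y \<mu> \<tau> S \<longleftrightarrow> (\<forall>\<theta>\<in>S. \<forall>r\<in>S. \<tau> \<theta> + (\<mu> \<theta> - y \<theta>)\<^sup>2 \<le> \<tau> r + (\<mu> r - y \<theta>)\<^sup>2)"

lemma ic_onD: "ic_on y \<mu> \<tau> S \<Longrightarrow> \<theta> \<in> S \<Longrightarrow> r \<in> S \<Longrightarrow>
    \<tau> \<theta> + (\<mu> \<theta> - y \<theta>)\<^sup>2 \<le> \<tau> r + (\<mu> r - y \<theta>)\<^sup>2"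
  by (auto simp: ic_on_def)

lemma ic_on_subset: "ic_on y \<mu> \<tau> S \<Longrightarrow> T \<subseteq> S \<Longrightarrow> ic_on y \<mu> \<tau> T"
  by (auto simp: ic_on_def)

lemma ic_on_cong:
  assumes "\<And>\<theta>. \<theta> \<in> S \<Longrightarrow> \<mu> \<theta> = \<mu>' \<theta>" "\<And>\<theta>. \<theta> \<in> S \<Longrightarrow> \<tau> \<theta> = \<tau>' \<theta>"
  shows "ic_on y \<mu> \<tau> S \<longleftrightarrow> ic_on y \<mu>' \<tau>' S"
  using assms by (auto simp: ic_on_def)

lemma ic_on_add_const: "ic_on y \<mu> (\<lambda>\<theta>. \<tau> \<theta> + k) S \<longleftrightarrow> ic_on y \<mu> \<tau> S"
  by (auto simp: ic_on_def)

text \<open>Adding the two constraints between \<open>r\<close> and \<open>s\<close> cancels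
  variances and squares and leaves a product of increments.\<close>

lemma ic_on_pair_mono:
  assumes "ic_on y \<mu> \<tau> S" "strict_mono_on S y" "r \<in> S" "s \<in> S" "r \<le> s"
  shows "\<mu> r \<le> \<mu> s"
proof (cases "r = s")
  case False
  then have "y r < y s" using assms by (auto dest: strict_mono_onD)
  have "0 \<le> (\<mu> s - \<mu> r) * (y s - y r)"
    using ic_onD[OF assms(1,3,4)] ic_onD[OF assms(1,4,3)]
    by (simp add: power2_eq_square algebra_simps)
  then show ?thesis using \<open>y r < y s\<close> by (simp add: zero_le_mult_iff)
qed auto

text \<open>Monotonicity of \<open>\<mu>\<close> splits the gain from a misreport across \<open>b\<close> into two nonpositive
  parts.\<close>

lemma ic_on_glue:
  fixes a b c :: real
  assumes 1: "ic_on y \<mu> \<tau> {a..b}" and 2: "ic_on y \<mu> \<tau> {b..c}"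
    and y: "strict_mono_on {a..c} y" and ab: "a \<le> b" "b \<le> c"
  shows "ic_on y \<mu> \<tau> {a..c}"
  unfolding ic_on_def
proof (intro ballI)
  fix \<theta> r assume \<theta>: "\<theta> \<in> {a..c}" and r: "r \<in> {a..c}"
  have y1: "strict_mono_on {a..b} y" and y2: "strict_mono_on {b..c} y"
    using y ab by (auto intro: monotone_on_subset)
  have ymono: "y u \<le> y v" if "u \<in> {a..c}" "v \<in> {a..c}" "u \<le> v" for u v
    using strict_mono_onD[OF y, of u v] that by (cases "u = v") auto
  consider "\<theta> \<le> b" "r \<le> b" | "b \<le> \<theta>" "b \<le> r" | "\<theta> \<le> b" "b \<le> r" | "b \<le> \<theta>" "r \<le> b"
    by linarith
  then show "\<tau> \<theta> + (\<mu> \<theta> - y \<theta>)\<^sup>2 \<le> \<tau> r + (\<mu> r - y \<theta>)\<^sup>2"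
  proof cases
    case 1
    then show ?thesis using ic_onD[OF assms(1), of \<theta> r] \<theta> r by auto
  next
    case 2
    then show ?thesis using ic_onD[OF assms(2), of \<theta> r] \<theta> r by auto
  next
    case 3
    have "\<mu> b \<le> \<mu> r" by (rule ic_on_pair_mono[OF 2 y2]) (use 3 r ab in auto)
    moreover have "y \<theta> \<le> y b" using ymono \<theta> 3 ab by auto
    ultimately have "0 \<le> (\<mu> r - \<mu> b) * (y b - y \<theta>)" by simp
    moreover have "\<tau> \<theta> + (\<mu> \<theta> - y \<theta>)\<^sup>2 \<le> \<tau> b + (\<mu> b - y \<theta>)\<^sup>2"
      by (rule ic_onD[OF 1]) (use 3 \<theta> ab in auto)
    moreover have "\<tau> b + (\<mu> b - y b)\<^sup>2 \<le> \<tau> r + (\<mu> r - y b)\<^sup>2"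
      by (rule ic_onD[OF 2]) (use 3 r ab in auto)
    ultimately show ?thesis by (simp add: power2_eq_square algebra_simps)
  next
    case 4
    have "\<mu> r \<le> \<mu> b" by (rule ic_on_pair_mono[OF 1 y1]) (use 4 r ab in auto)
    moreover have "y b \<le> y \<theta>" using ymono \<theta> 4 ab by auto
    ultimately have "0 \<le> (\<mu> b - \<mu> r) * (y \<theta> - y b)" by simp
    moreover have "\<tau> \<theta> + (\<mu> \<theta> - y \<theta>)\<^sup>2 \<le> \<tau> b + (\<mu> b - y \<theta>)\<^sup>2"
      by (rule ic_onD[OF 2]) (use 4 \<theta> ab in auto)
    moreover have "\<tau> b + (\<mu> b - y b)\<^sup>2 \<le> \<tau> r + (\<mu> r - y b)\<^sup>2"
      by (rule ic_onD[OF 1]) (use 4 r ab in auto)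
    ultimately show ?thesis by (simp add: power2_eq_square algebra_simps)
  qed
qed

text \<open>The assumed derivative of \<open>\<tau>\<close> is the first-order condition at the
  truth. It turns the marginal loss of type \<theta> from raising the report \<open>x\<close> into
  \<open>2 * \<mu>' x * (y x - y \<theta>)\<close>, whose sign is that of
  \<open>x - \<theta>\<close>, so local optimality is global.\<close>

lemma ic_on_local:
  fixes a b :: real
  assumes cont: "continuous_on {a..b} \<mu>" "continuous_on {a..b} \<tau>"
    and mono: "mono_on {a..b} y"
    and deriv: "\<And>x. x \<in> {a<..<b} \<Longrightarrow> (\<mu> has_real_derivative \<mu>' x) (at x)"
      "\<And>x. x \<in> {a<..<b} \<Longrightarrow> (\<tau> has_real_derivative - 2 * (\<mu> x - y x) * \<mu>' x) (at x)"
    and nonneg: "\<And>x. x \<in> {a<..<b} \<Longrightarrow> 0 \<le> \<mu>' x"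
  shows "ic_on y \<mu> \<tau> {a..b}"
  unfolding ic_on_def
proof (intro ballI)
  fix \<theta> r assume \<theta>: "\<theta> \<in> {a..b}" and r: "r \<in> {a..b}"
  define g where "g = (\<lambda>x. \<tau> x + (\<mu> x - y \<theta>)\<^sup>2)"
  have contg: "continuous_on {u..v} g" if "a \<le> u" "v \<le> b" for u v
    unfolding g_def
    by (intro continuous_intros continuous_on_subset[OF cont(1)] continuous_on_subset[OF cont(2)])
      (use that in auto)
  have dg: "(g has_real_derivative 2 * \<mu>' x * (y x - y \<theta>)) (at x)" if "x \<in> {a<..<b}" for x
    unfolding g_def using that
    by (auto intro!: derivative_eq_intros deriv simp: algebra_simps)
  show "\<tau> \<theta> + (\<mu> \<theta> - y \<theta>)\<^sup>2 \<le> \<tau> r + (\<mu> r - y \<theta>)\<^sup>2"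
  proof (cases "\<theta> \<le> r")
    case True
    have "g \<theta> \<le> g r"
    proof (rule DERIV_nonneg_imp_increasing_open[OF True])
      fix x assume x: "\<theta> < x" "x < r"
      then have "0 \<le> 2 * \<mu>' x * (y x - y \<theta>)"
        using nonneg[of x] mono_onD[OF mono, of \<theta> x] \<theta> r by auto
      then show "\<exists>D. DERIV g x :> D \<and> 0 \<le> D" using dg[of x] x \<theta> r by auto
    qed (use contg \<theta> r in auto)
    then show ?thesis by (simp add: g_def)
  next
    case False
    have "g \<theta> \<le> g r"
    proof (rule DERIV_nonpos_imp_decreasing_open[of r \<theta>])
      fix x assume x: "r < x" "x < \<theta>"
      then have "2 * \<mu>' x * (y x - y \<theta>) \<le> 0"
        using nonneg[of x] mono_onD[OF mono, of x \<theta>] \<theta> r by (auto simp: mult_le_0_iff)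
      then show "\<exists>D. DERIV g x :> D \<and> D \<le> 0" using dg[of x] x \<theta> r by auto
    qed (use False contg \<theta> r in auto)
    then show ?thesis by (simp add: g_def)
  qed
qed

text \<open>Optimality for the worst loss, free of kernels and probability. Competitors are all
  pairs of functions satisfying the constraints; \<open>B\<close> stands for the compactness of the
  action set, and \<open>K\<close> for any bound on the competitor's loss.\<close>

definition minimax_on ::
    "(real \<Rightarrow> real) \<Rightarrow> (real \<Rightarrow> real) \<Rightarrow> real \<Rightarrow> real \<Rightarrow> (real \<Rightarrow> real) \<Rightarrow> (real \<Rightarrow> real) \<Rightarrow> real \<Rightarrow> bool" where
  "minimax_on zP zA \<alpha> \<beta> \<mu> \<tau> w \<longleftrightarrow>
     ic_on zA \<mu> \<tau> {\<alpha>..\<beta>} \<and> (\<forall>\<theta>\<in>{\<alpha>..\<beta>}. \<tau> \<theta> + (\<mu> \<theta> - zP \<theta>)\<^sup>2 \<le> w) \<and>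
     (\<forall>\<mu>' \<tau>' B K. ic_on zA \<mu>' \<tau>' {\<alpha>..\<beta>} \<longrightarrow> (\<forall>\<theta>\<in>{\<alpha>..\<beta>}. \<bar>\<mu>' \<theta>\<bar> \<le> B \<and> 0 \<le> \<tau>' \<theta>) \<longrightarrow>
        (\<forall>\<theta>\<in>{\<alpha>..\<beta>}. \<tau>' \<theta> + (\<mu>' \<theta> - zP \<theta>)\<^sup>2 \<le> K) \<longrightarrow> w \<le> K)"

lemma ic_on_reflect:
  assumes "ic_on y \<mu> \<tau> {\<alpha>..\<beta>}"
  shows "ic_on (reflect \<kappa> \<alpha> \<beta> y) (reflect \<kappa> \<alpha> \<beta> \<mu>) (\<lambda>\<theta>. \<tau> (\<alpha> + \<beta> - \<theta>)) {\<alpha>..\<beta>}"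
  unfolding ic_on_def
proof (intro ballI)
  fix \<theta> r assume "\<theta> \<in> {\<alpha>..\<beta>}" "r \<in> {\<alpha>..\<beta>}"
  then have "\<tau> (\<alpha>+\<beta>-\<theta>) + (\<mu> (\<alpha>+\<beta>-\<theta>) - y (\<alpha>+\<beta>-\<theta>))\<^sup>2 \<le> \<tau> (\<alpha>+\<beta>-r) + (\<mu> (\<alpha>+\<beta>-r) - y (\<alpha>+\<beta>-\<theta>))\<^sup>2"
    by (intro ic_onD[OF assms]) auto
  then show "\<tau> (\<alpha>+\<beta>-\<theta>) + (reflect \<kappa> \<alpha> \<beta> \<mu> \<theta> - reflect \<kappa> \<alpha> \<beta> y \<theta>)\<^sup>2
      \<le> \<tau> (\<alpha>+\<beta>-r) + (reflect \<kappa> \<alpha> \<beta> \<mu> r - reflect \<kappa> \<alpha> \<beta> y \<theta>)\<^sup>2"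
    by (simp add: reflect_def power2_commute)
qed

lemma reflect_reflect: "reflect \<kappa> \<alpha> \<beta> (reflect \<kappa> \<alpha> \<beta> y) = y"
  by (auto simp: reflect_def)

text \<open>Reflecting types and actions together preserves squared distances and the order, but
  flips the sign of the bias. As an involution it carries every competitor of the original problem
  to one of the reflected problem with the same loss bound.\<close>

lemma minimax_on_reflect:
  assumes "minimax_on (reflect \<kappa> \<alpha> \<beta> zP) (reflect \<kappa> \<alpha> \<beta> zA) \<alpha> \<beta> \<mu> \<tau> w"
  shows "minimax_on zP zA \<alpha> \<beta> (reflect \<kappa> \<alpha> \<beta> \<mu>) (\<lambda>\<theta>. \<tau> (\<alpha> + \<beta> - \<theta>)) w"
proof -
  note m = assms[unfolded minimax_on_def]
  have "ic_on zA (reflect \<kappa> \<alpha> \<beta> \<mu>) (\<lambda>\<theta>. \<tau> (\<alpha> + \<beta> - \<theta>)) {\<alpha>..\<beta>}"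
    using ic_on_reflect[where \<kappa>=\<kappa>, OF m[THEN conjunct1]] by (simp only: reflect_reflect)
  moreover have "\<tau> (\<alpha>+\<beta>-\<theta>) + (reflect \<kappa> \<alpha> \<beta> \<mu> \<theta> - zP \<theta>)\<^sup>2 \<le> w" if "\<theta> \<in> {\<alpha>..\<beta>}" for \<theta>
  proof -
    have "\<tau> (\<alpha>+\<beta>-\<theta>) + (\<mu> (\<alpha>+\<beta>-\<theta>) - reflect \<kappa> \<alpha> \<beta> zP (\<alpha>+\<beta>-\<theta>))\<^sup>2 \<le> w"
      using m that by auto
    then show ?thesis by (simp add: reflect_def power2_eq_square algebra_simps)
  qed
  moreover have "w \<le> K" if ic: "ic_on zA \<mu>' \<tau>' {\<alpha>..\<beta>}"
    and B: "\<forall>\<theta>\<in>{\<alpha>..\<beta>}. \<bar>\<mu>' \<theta>\<bar> \<le> B \<and> 0 \<le> \<tau>' \<theta>"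
    and K: "\<forall>\<theta>\<in>{\<alpha>..\<beta>}. \<tau>' \<theta> + (\<mu>' \<theta> - zP \<theta>)\<^sup>2 \<le> K" for \<mu>' \<tau>' B K
  proof -
    have "\<bar>reflect \<kappa> \<alpha> \<beta> \<mu>' \<theta>\<bar> \<le> \<bar>\<kappa>\<bar> + B \<and> 0 \<le> \<tau>' (\<alpha>+\<beta>-\<theta>)" if "\<theta> \<in> {\<alpha>..\<beta>}" for \<theta>
      using B[rule_format, of "\<alpha>+\<beta>-\<theta>"] that by (auto simp: reflect_def abs_le_iff)
    moreover have "\<tau>' (\<alpha>+\<beta>-\<theta>) + (reflect \<kappa> \<alpha> \<beta> \<mu>' \<theta> - reflect \<kappa> \<alpha> \<beta> zP \<theta>)\<^sup>2 \<le> K"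
      if "\<theta> \<in> {\<alpha>..\<beta>}" for \<theta>
      using K[rule_format, of "\<alpha>+\<beta>-\<theta>"] that by (auto simp: reflect_def power2_commute)
    ultimately show ?thesis
      using m[THEN conjunct2, THEN conjunct2, rule_format, OF ic_on_reflect[where \<kappa>=\<kappa>, OF ic]] by blast
  qed
  ultimately show ?thesis unfolding minimax_on_def by blast
qed

section \<open>The flow of the regional construction\<close>

locale biased_interval =
  fixes zP zA zP' zA' :: "real \<Rightarrow> real" and \<alpha> \<beta> :: real
  assumes \<alpha>\<beta>: "\<alpha> < \<beta>"
    and derivP: "\<And>x. x \<in> {\<alpha>..\<beta>} \<Longrightarrow> (zP has_real_derivative zP' x) (at x within {\<alpha>..\<beta>})"
    and derivA: "\<And>x. x \<in> {\<alpha>..\<beta>} \<Longrightarrow> (zA has_real_derivative zA' x) (at x within {\<alpha>..\<beta>})"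
    and contP': "continuous_on {\<alpha>..\<beta>} zP'"
    and monoP: "strict_mono_on {\<alpha>..\<beta>} zP"
    and monoA: "strict_mono_on {\<alpha>..\<beta>} zA"
begin

definition c :: "real \<Rightarrow> real" where "c t = zA t - zP t"

text \<open>\<open>E p\<close> is the integrating factor of the flow, with
  \<open>(E p)' = - (zP' / c) * E p\<close>; \<open>J p\<close> collects the contribution of the
  inhomogeneous term \<open>zP'\<close>.\<close>

definition E :: "real \<Rightarrow> real \<Rightarrow> real" where
  "E \<theta> t = exp (- integral {\<theta>..t} (\<lambda>s. zP' s / c s))"

definition J :: "real \<Rightarrow> real \<Rightarrow> real" where
  "J \<theta> t = integral {\<theta>..t} (\<lambda>s. zP' s * E \<theta> s)"

abbreviation "\<theta>b \<equiv> theta_bar zP zA \<alpha> \<beta>"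
abbreviation "\<theta>l \<equiv> theta_low zP zA \<alpha> \<beta>"
abbreviation "d \<equiv> d_fun zP zA \<alpha> \<beta>"

lemma contP: "continuous_on {\<alpha>..\<beta>} zP"
  by (rule DERIV_continuous_on[OF derivP])

lemma contA: "continuous_on {\<alpha>..\<beta>} zA"
  by (rule DERIV_continuous_on[OF derivA])

lemma contc: "continuous_on {\<alpha>..\<beta>} c"
  unfolding c_def by (intro continuous_intros contP contA)

lemma derivc: "x \<in> {\<alpha>..\<beta>} \<Longrightarrow> (c has_real_derivative zA' x - zP' x) (at x within {\<alpha>..\<beta>})"
  unfolding c_def by (auto intro!: derivative_eq_intros derivP derivA)

lemma zP'_nonneg: "x \<in> {\<alpha>..\<beta>} \<Longrightarrow> 0 \<le> zP' x"
  using strict_mono_on_deriv_nonneg[OF \<alpha>\<beta> _ monoP derivP] by blast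

lemma zP_le: "u \<in> {\<alpha>..\<beta>} \<Longrightarrow> v \<in> {\<alpha>..\<beta>} \<Longrightarrow> u \<le> v \<Longrightarrow> zP u \<le> zP v"
  and zA_le: "u \<in> {\<alpha>..\<beta>} \<Longrightarrow> v \<in> {\<alpha>..\<beta>} \<Longrightarrow> u \<le> v \<Longrightarrow> zA u \<le> zA v"
  using monoP monoA by (auto simp: strict_mono_on_leD)

lemma theta_bar:
  assumes "zA \<alpha> \<le> zP \<beta>" "zP \<beta> \<le> zA \<beta>"
  shows "\<theta>b \<in> {\<alpha>..\<beta>}" "zA \<theta>b = zP \<beta>"
proof -
  have inj: "inj_on zA {\<alpha>..\<beta>}" using monoA by (rule strict_mono_on_imp_inj_on)
  obtain t where t: "\<alpha> \<le> t" "t \<le> \<beta>" "zA t = zP \<beta>"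
    using IVT'[of zA \<alpha> "zP \<beta>" \<beta>] assms \<alpha>\<beta> contA by auto
  then have "zP \<beta> \<in> zA ` {\<alpha>..\<beta>}" by force
  then show "\<theta>b \<in> {\<alpha>..\<beta>}" "zA \<theta>b = zP \<beta>"
    unfolding theta_bar_def
    using the_inv_into_into[OF inj _ order_refl] f_the_inv_into_f[OF inj] by auto
qed

text \<open>Derivatives within a nondegenerate closed interval are unique, so the one named in
  \<open>d_fun\<close> may be replaced by \<open>zP'\<close> under both integrals.\<close>

lemma d_eq:
  assumes "\<theta> \<in> {\<alpha>..\<beta>}" "\<theta>b \<in> {\<alpha>..\<beta>}"
  shows "d \<theta> = c \<theta>b / 2 * E \<theta> \<theta>b + J \<theta> \<theta>b"
proof -
  have vd: "vector_derivative zP (at t within {\<alpha>..\<beta>}) = zP' t" if "t \<in> {\<alpha>..\<beta>}" for t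
    using vector_derivative_within_closed_interval[OF \<alpha>\<beta> that]
      derivP[OF that, unfolded has_real_derivative_iff_has_vector_derivative] by blast
  have i: "integral {\<theta>..t} (\<lambda>t. vector_derivative zP (at t within {\<alpha>..\<beta>}) / (zA t - zP t))
      = integral {\<theta>..t} (\<lambda>s. zP' s / c s)" if "t \<le> \<beta>" for t
    by (rule integral_cong) (use that assms in \<open>auto simp: vd c_def\<close>)
  have "integral {\<theta>..\<theta>b} (\<lambda>t. vector_derivative zP (at t within {\<alpha>..\<beta>}) *
      exp (- integral {\<theta>..t} (\<lambda>s. vector_derivative zP (at s within {\<alpha>..\<beta>}) / (zA s - zP s))))
      = J \<theta> \<theta>b"
    unfolding J_def E_def by (rule integral_cong) (use assms in \<open>auto simp: vd i\<close>)
  then show ?thesis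
    using i[of \<theta>b] assms by (simp add: d_fun_def Let_def E_def c_def)
qed

lemma E_pos: "E p t > 0" by (simp add: E_def)

lemma E_self [simp]: "E p p = 1" by (simp add: E_def)

lemma J_self [simp]: "J p p = 0" by (simp add: J_def)

text \<open>On such an interval \<open>zP' / c\<close> is continuous up to both ends, so classical
  calculus applies to \<open>E\<close> and \<open>J\<close>; the zero of \<open>c\<close> is reached
  only by limits.\<close>

definition regular :: "real \<Rightarrow> real \<Rightarrow> bool" where
  "regular p t \<longleftrightarrow> \<alpha> \<le> p \<and> p \<le> t \<and> t \<le> \<beta> \<and> (\<forall>s\<in>{p..t}. c s > 0)"

lemma regularD: "regular p t \<Longrightarrow> s \<in> {p..t} \<Longrightarrow> c s > 0 \<and> s \<in> {\<alpha>..\<beta>}"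
  by (auto simp: regular_def)

lemma regular_sub: "regular p t \<Longrightarrow> p \<le> u \<Longrightarrow> u \<le> v \<Longrightarrow> v \<le> t \<Longrightarrow> regular u v"
  by (auto simp: regular_def)

lemma cont_q:
  assumes "regular p t"
  shows "continuous_on {p..t} (\<lambda>s. zP' s / c s)"
proof -
  have "\<forall>s\<in>{p..t}. c s \<noteq> 0" "{p..t} \<subseteq> {\<alpha>..\<beta>}" using regularD[OF assms] by force+
  then show ?thesis
    by (intro continuous_on_divide continuous_on_subset[OF contP'] continuous_on_subset[OF contc])
qed

lemma E_mult:
  assumes "regular p t" "s \<in> {p..t}"
  shows "E p s * E s t = E p t"
proof -
  have "integral {p..s} (\<lambda>s. zP' s / c s) + integral {s..t} (\<lambda>s. zP' s / c s)
      = integral {p..t} (\<lambda>s. zP' s / c s)"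
    by (rule Henstock_Kurzweil_Integration.integral_combine)
      (use assms in \<open>auto intro: integrable_continuous_real cont_q\<close>)
  then show ?thesis by (simp add: E_def flip: exp_add)
qed

lemma deriv_E:
  assumes "regular p t" "s \<in> {p..t}"
  shows "(E p has_real_derivative - (zP' s / c s) * E p s) (at s within {p..t})"
  unfolding E_def
  by (auto intro!: derivative_eq_intros integral_has_real_derivative[OF cont_q[OF assms(1)] assms(2)])

lemma cont_E: "regular p t \<Longrightarrow> continuous_on {p..t} (E p)"
  by (rule DERIV_continuous_on[OF deriv_E])

lemma cont_zP'E:
  assumes "regular p t"
  shows "continuous_on {p..t} (\<lambda>s. zP' s * E p s)"
  using assms by (intro continuous_intros cont_E continuous_on_subset[OF contP'])
    (auto simp: regular_def)

lemma deriv_J: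
  assumes "regular p t" "s \<in> {p..t}"
  shows "(J p has_real_derivative zP' s * E p s) (at s within {p..t})"
  unfolding J_def by (rule integral_has_real_derivative[OF cont_zP'E]) (use assms in auto)

lemma E_antimono:
  assumes "regular p t" "u \<in> {p..t}" "v \<in> {p..t}" "u \<le> v"
  shows "E p v \<le> E p u"
proof -
  have "0 \<le> integral {u..v} (\<lambda>s. zP' s / c s)"
  proof (rule integral_nonneg)
    show "(\<lambda>s. zP' s / c s) integrable_on {u..v}"
      using cont_q[OF regular_sub[OF assms(1)], of u v] assms by (auto intro: integrable_continuous_real)
    show "0 \<le> zP' s / c s" if "s \<in> {u..v}" for s
      using that assms regularD[OF assms(1), of s] zP'_nonneg[of s] by auto
  qed
  then have "E u v \<le> 1" by (simp add: E_def)
  moreover have "E p u * E u v = E p v"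
    using E_mult[OF regular_sub[OF assms(1)], of p v u] assms by auto
  ultimately show ?thesis using E_pos[of p u] by (metis mult.right_neutral mult_le_cancel_left_pos)
qed

text \<open>Meant for an endpoint \<open>t\<close> where \<open>c\<close> may vanish: the
  multiplicative law of \<open>E\<close> is available only before \<open>t\<close>, and the single
  point \<open>t\<close> does not affect the integrals.\<close>

lemma J_split_integrable:
  assumes reg: "regular p s" and "s \<le> t" "t \<le> \<beta>"
    and E: "\<And>u. u \<in> {s..<t} \<Longrightarrow> regular p u"
    and int: "(\<lambda>u. zP' u * E s u) integrable_on {s..t}"
  shows "(\<lambda>u. zP' u * E p u) integrable_on {p..t}" "J p t = J p s + E p s * J s t"
proof -
  have eq: "zP' u * E p u = E p s * (zP' u * E s u)" if "u \<in> {s..t} - {t}" for u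
    using E_mult[OF E, of u s] that reg by (auto simp: regular_def)
  have int2: "(\<lambda>u. zP' u * E p u) integrable_on {s..t}"
    by (rule integrable_spike_finite[of "{t}", OF _ eq integrable_on_mult_right[OF int]]) auto
  have "integral {s..t} (\<lambda>u. zP' u * E p u) = integral {s..t} (\<lambda>u. E p s * (zP' u * E s u))"
    by (rule integral_spike[OF negligible_sing eq[symmetric]])
  then have J2: "integral {s..t} (\<lambda>u. zP' u * E p u) = E p s * J s t"
    by (simp add: J_def)
  have int1: "(\<lambda>u. zP' u * E p u) integrable_on {p..s}"
    by (intro integrable_continuous_real cont_zP'E reg)
  have ps: "p \<le> s" using reg by (auto simp: regular_def)
  show int3: "(\<lambda>u. zP' u * E p u) integrable_on {p..t}"
    by (rule Henstock_Kurzweil_Integration.integrable_combine[OF ps \<open>s \<le> t\<close> int1 int2])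
  show "J p t = J p s + E p s * J s t"
    using Henstock_Kurzweil_Integration.integral_combine[OF ps \<open>s \<le> t\<close> int3] J2 by (simp add: J_def)
qed

lemma J_split:
  assumes "regular p t" "s \<in> {p..t}"
  shows "J p t = J p s + E p s * J s t"
proof (rule J_split_integrable)
  show "(\<lambda>u. zP' u * E s u) integrable_on {s..t}"
    using assms by (intro integrable_continuous_real cont_zP'E) (auto simp: regular_def)
qed (use assms in \<open>auto simp: regular_def\<close>)

lemma J_nonneg: "regular p t \<Longrightarrow> 0 \<le> J p t"
  unfolding J_def
  by (intro integral_nonneg integrable_continuous_real cont_zP'E)
    (auto simp: zP'_nonneg regular_def E_pos less_imp_le)

text \<open>Since \<open>zP' * E p = - c * (E p)'\<close>, a bound on \<open>c\<close> turns \<open>J p t\<close> into a multiple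
  of \<open>1 - E p t\<close>.\<close>

lemma integral_qE:
  assumes "regular p t"
  shows "((\<lambda>s. k * (zP' s / c s * E p s)) has_integral k * (1 - E p t)) {p..t}"
proof -
  have "((\<lambda>s. k * (zP' s / c s * E p s)) has_integral (- k * E p t - - k * E p p)) {p..t}"
  proof (rule fundamental_theorem_of_calculus)
    show "p \<le> t" using assms by (auto simp: regular_def)
    show "((\<lambda>s. - k * E p s) has_vector_derivative k * (zP' s / c s * E p s)) (at s within {p..t})"
      if "s \<in> {p..t}" for s
      unfolding has_real_derivative_iff_has_vector_derivative[symmetric]
      by (auto intro!: derivative_eq_intros deriv_E[OF assms that])
  qed
  then show ?thesis by (simp add: algebra_simps)
qed

lemma J_has_integral: "regular p t \<Longrightarrow> ((\<lambda>s. zP' s * E p s) has_integral J p t) {p..t}"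
  unfolding J_def by (intro integrable_integral integrable_continuous_real cont_zP'E)

lemma J_ge:
  assumes "regular p t" "\<And>s. s \<in> {p..t} \<Longrightarrow> k \<le> c s"
  shows "k * (1 - E p t) \<le> J p t"
proof (rule has_integral_le[OF integral_qE[OF assms(1)] J_has_integral[OF assms(1)]])
  fix s assume s: "s \<in> {p..t}"
  then have "k * (zP' s / c s) \<le> c s * (zP' s / c s)"
    using assms(2)[OF s] regularD[OF assms(1) s] zP'_nonneg[of s] by (intro mult_right_mono) auto
  also have "\<dots> = zP' s" using regularD[OF assms(1) s] by simp
  finally show "k * (zP' s / c s * E p s) \<le> zP' s * E p s"
    using E_pos[of p s] by (simp only: mult.assoc[symmetric] mult_le_cancel_right_pos)
qed

lemma J_le:
  assumes "regular p t" "\<And>s. s \<in> {p..t} \<Longrightarrow> c s \<le> k"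
  shows "J p t \<le> k * (1 - E p t)"
proof (rule has_integral_le[OF J_has_integral[OF assms(1)] integral_qE[OF assms(1)]])
  fix s assume s: "s \<in> {p..t}"
  have "zP' s = c s * (zP' s / c s)" using regularD[OF assms(1) s] by simp
  also have "\<dots> \<le> k * (zP' s / c s)"
    using assms(2)[OF s] regularD[OF assms(1) s] zP'_nonneg[of s] by (intro mult_right_mono) auto
  finally show "zP' s * E p s \<le> k * (zP' s / c s * E p s)"
    using E_pos[of p s] by (simp only: mult.assoc[symmetric] mult_le_cancel_right_pos)
qed

text \<open>\<open>f p = E p t * f t + J p t\<close> is the variation-of-constants form of
  \<open>f' = zP' * (f / c - 1)\<close>, the equation that makes \<open>(zP + f, K - f\<^sup>2)\<close> incentive
  compatible.\<close>

lemma flow_eq: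
  assumes "f p = E p s * f s + J p s"
  shows "f s = (f p - J p s) / E p s"
  using assms E_pos[of p s] by (simp add: field_simps)

lemma flow_deriv:
  assumes reg: "regular p t" and flow: "\<And>s. s \<in> {p..t} \<Longrightarrow> f p = E p s * f s + J p s"
    and s: "s \<in> {p..t}"
  shows "(f has_real_derivative zP' s * (f s / c s - 1)) (at s within {p..t})"
proof -
  have "((\<lambda>s. (f p - J p s) / E p s) has_real_derivative zP' s * (f s / c s - 1)) (at s within {p..t})"
    by (rule derivative_eq_intros deriv_E[OF reg s] deriv_J[OF reg s] refl)+
      (use E_pos[of p s] regularD[OF reg s] in \<open>auto simp: flow[OF s] field_simps\<close>)
  then show ?thesis
    by (rule has_field_derivative_transform_within[OF _ zero_less_one s])
      (rule flow_eq[where f=f and p=p, symmetric], rule flow)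
qed

section \<open>Lower bound for arbitrary incentive compatible mechanisms\<close>

text \<open>The numerator of the supersolution \<open>D\<close>. It is kept apart from the factor
  \<open>1 / (2 * c)\<close> because it stays continuous where \<open>c\<close> vanishes.\<close>

definition M :: "(real \<Rightarrow> real) \<Rightarrow> (real \<Rightarrow> real) \<Rightarrow> real \<Rightarrow> real \<Rightarrow> real" where
  "M \<mu> \<tau> K \<theta> = K - (\<tau> \<theta> + (\<mu> \<theta> - zA \<theta>)\<^sup>2) + (c \<theta>)\<^sup>2"

context
  fixes \<mu> \<tau> :: "real \<Rightarrow> real" and B :: real
  assumes ic: "ic_on zA \<mu> \<tau> {\<alpha>..\<beta>}" and B: "\<And>\<theta>. \<theta> \<in> {\<alpha>..\<beta>} \<Longrightarrow> \<bar>\<mu> \<theta>\<bar> \<le> B"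
begin

text \<open>The envelope inequality: type \<open>r\<close> imitates \<open>s\<close>. The variance
  and the square of \<open>\<mu> s\<close> drop out, so the bound is linear in
  \<open>\<mu> s\<close>.\<close>

lemma agent_loss_diff_le:
  assumes "r \<in> {\<alpha>..\<beta>}" "s \<in> {\<alpha>..\<beta>}"
  shows "(\<tau> r + (\<mu> r - zA r)\<^sup>2) - (\<tau> s + (\<mu> s - zA s)\<^sup>2)
      \<le> 2 * \<mu> s * (zA s - zA r) - ((zA s)\<^sup>2 - (zA r)\<^sup>2)"
  using ic_onD[OF ic assms] by (simp add: power2_eq_square algebra_simps)

text \<open>Up to the term \<open>(zA \<theta>)^2\<close>, the agent's loss is a minimum over
  reports of functions affine in \<open>zA \<theta>\<close> with slopes at most \<open>2 * B\<close>
  in absolute value. Hence it is Lipschitz in \<open>zA\<close>, although \<open>\<mu>\<close> and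
  \<open>\<tau>\<close> may jump.\<close>

lemma agent_loss_continuous: "continuous_on {\<alpha>..\<beta>} (\<lambda>\<theta>. \<tau> \<theta> + (\<mu> \<theta> - zA \<theta>)\<^sup>2)"
proof -
  define f where "f \<theta> = \<tau> \<theta> + (\<mu> \<theta> - zA \<theta>)\<^sup>2 - (zA \<theta>)\<^sup>2" for \<theta>
  have le: "f r - f s \<le> 2 * B * \<bar>zA r - zA s\<bar>" if "r \<in> {\<alpha>..\<beta>}" "s \<in> {\<alpha>..\<beta>}" for r s
  proof -
    have "f r - f s \<le> 2 * (\<mu> s * (zA s - zA r))"
      using agent_loss_diff_le[OF that] by (simp add: f_def algebra_simps)
    also have "\<mu> s * (zA s - zA r) \<le> \<bar>\<mu> s\<bar> * \<bar>zA r - zA s\<bar>"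
      by (metis abs_ge_self abs_minus_commute abs_mult)
    also have "\<dots> \<le> B * \<bar>zA r - zA s\<bar>" using B[OF that(2)] by (rule mult_right_mono) simp
    finally show ?thesis by simp
  qed
  have "continuous_on {\<alpha>..\<beta>} f"
    unfolding continuous_on_def
  proof
    fix s assume s: "s \<in> {\<alpha>..\<beta>}"
    have "((\<lambda>r. f r - f s) \<longlongrightarrow> 0) (at s within {\<alpha>..\<beta>})"
    proof (rule Lim_null_comparison)
      show "\<forall>\<^sub>F r in at s within {\<alpha>..\<beta>}. norm (f r - f s) \<le> 2 * B * \<bar>zA r - zA s\<bar>"
        using le[OF _ s] le[OF s]
        by (auto simp: eventually_at_filter abs_le_iff abs_minus_commute intro!: always_eventually)
      have "(zA \<longlongrightarrow> zA s) (at s within {\<alpha>..\<beta>})" using contA s by (simp add: continuous_on_def)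
      then show "((\<lambda>r. 2 * B * \<bar>zA r - zA s\<bar>) \<longlongrightarrow> 0) (at s within {\<alpha>..\<beta>})"
        by (auto intro!: tendsto_eq_intros)
    qed
    then show "(f \<longlongrightarrow> f s) (at s within {\<alpha>..\<beta>})" by (simp add: LIM_zero_iff)
  qed
  then have "continuous_on {\<alpha>..\<beta>} (\<lambda>\<theta>. f \<theta> + (zA \<theta>)\<^sup>2)"
    by (intro continuous_intros contA)
  then show ?thesis by (simp add: f_def)
qed

lemma M_eq: "M \<mu> \<tau> K \<theta> = K - (\<tau> \<theta> + (\<mu> \<theta> - zP \<theta>)\<^sup>2) + 2 * c \<theta> * (\<mu> \<theta> - zP \<theta>)"
  by (simp add: M_def c_def power2_eq_square algebra_simps)

lemma M_continuous: "continuous_on {\<alpha>..\<beta>} (M \<mu> \<tau> K)"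
  unfolding M_def by (intro continuous_intros agent_loss_continuous contc)

text \<open>\<open>M \<mu> \<tau> K / (2 * c)\<close> bounds \<open>\<mu> - zP\<close> from above when no loss exceeds \<open>K\<close>, and by
  incentive compatibility it is a supersolution of the flow.\<close>

lemma supersolution:
  assumes reg: "regular p t"
    and K: "\<And>\<theta>. \<theta> \<in> {\<alpha>..\<beta>} \<Longrightarrow> \<tau> \<theta> + (\<mu> \<theta> - zP \<theta>)\<^sup>2 \<le> K"
  shows "E p t * (M \<mu> \<tau> K t / (2 * c t)) + J p t \<le> M \<mu> \<tau> K p / (2 * c p)"
proof -
  define G where "G s = E p s / (2 * c s)" for s
  define W where "W s = M \<mu> \<tau> K s * G s + J p s" for s
  have sub: "{p..t} \<subseteq> {\<alpha>..\<beta>}" and pt: "p \<le> t" using reg by (auto simp: regular_def)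
  have contG: "continuous_on {p..t} G"
    unfolding G_def using regularD[OF reg]
    by (intro continuous_intros cont_E reg continuous_on_subset[OF contc sub]) force
  have contJ: "continuous_on {p..t} (J p)"
    by (rule DERIV_continuous_on[OF deriv_J[OF reg]])
  have "W t \<le> W p"
  proof (rule antimono_if_left_difference_quotient_le[where f=W and a=p and b=t])
    show "continuous_on {p..t} W"
      unfolding W_def by (intro continuous_intros contG contJ continuous_on_subset[OF M_continuous sub])
    show "p \<le> t" by fact
    fix s assume s: "s \<in> {p<..t}"
    then have sI: "s \<in> {p..t}" "s \<in> {\<alpha>..\<beta>}" "c s > 0" using regularD[OF reg, of s] by auto
    \<comment> \<open>The upper bound for \<open>\<mu> s\<close> that the loss bound
      \<open>K\<close> provides. Replacing \<open>\<mu> s\<close> by \<open>m\<close> in the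
      envelope inequality gives \<open>b\<close>, and \<open>g\<close> bounds the increment of
      \<open>W\<close> by a discrete product rule.\<close>
    define m where "m = zP s + M \<mu> \<tau> K s / (2 * c s)"
    define b where "b r = 2 * m * (zA s - zA r) - ((zA s)\<^sup>2 - (zA r)\<^sup>2) + ((c s)\<^sup>2 - (c r)\<^sup>2)" for r
    define g where "g r = G s * b r + M \<mu> \<tau> K r * (G s - G r) + (J p s - J p r)" for r
    have \<mu>m: "\<mu> s \<le> m"
      using K[OF sI(2)] sI(3) M_eq[of K s] by (simp add: m_def field_simps)
    have "W s - W r \<le> g r" if r: "r \<in> {p..<s}" for r
    proof -
      have rI: "r \<in> {\<alpha>..\<beta>}" using r s sub by auto
      have "M \<mu> \<tau> K s - M \<mu> \<tau> K r \<le> b r"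
      proof -
        have "2 * \<mu> s * (zA s - zA r) \<le> 2 * m * (zA s - zA r)"
          using \<mu>m zA_le[OF rI sI(2)] r by (intro mult_right_mono) auto
        then show ?thesis using agent_loss_diff_le[OF rI sI(2)] by (simp add: M_def b_def)
      qed
      then have "(M \<mu> \<tau> K s - M \<mu> \<tau> K r) * G s \<le> b r * G s"
        using E_pos[of p s] sI(3) by (intro mult_right_mono) (auto simp: G_def)
      moreover have "W s - W r = (M \<mu> \<tau> K s - M \<mu> \<tau> K r) * G s + M \<mu> \<tau> K r * (G s - G r) + (J p s - J p r)"
        by (simp add: W_def left_diff_distrib right_diff_distrib)
      ultimately show ?thesis by (simp add: g_def mult.commute)
    qed
    moreover have "((\<lambda>r. g r / (s - r)) \<longlongrightarrow> 0) (at_left s)"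
    proof -
      let ?F = "at s within {p..s}"
      have quot: "((\<lambda>r. (f s - f r) / (s - r)) \<longlongrightarrow> D) ?F"
        if "(f has_real_derivative D) (at s within S)" "{p..s} \<subseteq> S" for f D S
      proof -
        have "((\<lambda>r. (f r - f s) / (r - s)) \<longlongrightarrow> D) ?F"
          using DERIV_subset[OF that] by (simp add: has_field_derivative_iff)
        then show ?thesis
          by (rule Lim_transform_eventually)
            (auto simp: eventually_at_filter field_simps intro!: always_eventually)
      qed
      have ps: "{p..s} \<subseteq> {\<alpha>..\<beta>}" "{p..s} \<subseteq> {p..t}" using sub s by auto
      have q1: "((\<lambda>r. (zA s - zA r) / (s - r)) \<longlongrightarrow> zA' s) ?F"
        by (rule quot[OF derivA[OF sI(2)] ps(1)])
      have q2: "((\<lambda>r. ((zA s)\<^sup>2 - (zA r)\<^sup>2) / (s - r)) \<longlongrightarrow> 2 * zA s * zA' s) ?F"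
        by (rule quot[OF _ ps(1), of "\<lambda>r. (zA r)\<^sup>2"])
          (auto intro!: derivative_eq_intros derivA sI(2))
      have q3: "((\<lambda>r. ((c s)\<^sup>2 - (c r)\<^sup>2) / (s - r)) \<longlongrightarrow> 2 * c s * (zA' s - zP' s)) ?F"
        by (rule quot[OF _ ps(1), of "\<lambda>r. (c r)\<^sup>2"])
          (auto intro!: derivative_eq_intros derivc sI(2))
      have q4: "((\<lambda>r. (J p s - J p r) / (s - r)) \<longlongrightarrow> zP' s * E p s) ?F"
        by (rule quot[OF deriv_J[OF reg sI(1)] ps(2)])
      \<comment> \<open>The derivative of \<open>E p\<close> cancels the \<open>zP'\<close> part of
        the derivative of \<open>c\<close>, so only \<open>zA'\<close> survives.\<close>
      have dG: "(G has_real_derivative - E p s * zA' s / (2 * (c s)\<^sup>2)) (at s within {p..t})"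
        unfolding G_def
        by (rule derivative_eq_intros deriv_E[OF reg sI(1)] DERIV_subset[OF derivc[OF sI(2)] sub] refl)+
          (use sI(3) in \<open>auto simp: field_simps power2_eq_square\<close>)
      have q5: "((\<lambda>r. (G s - G r) / (s - r)) \<longlongrightarrow> - E p s * zA' s / (2 * (c s)\<^sup>2)) ?F"
        by (rule quot[OF dG ps(2)])
      have q6: "(M \<mu> \<tau> K \<longlongrightarrow> M \<mu> \<tau> K s) ?F"
        using continuous_on_subset[OF M_continuous ps(1)] s by (auto simp: continuous_on_def)
      have "((\<lambda>r. G s * (2 * m * ((zA s - zA r) / (s - r)) - ((zA s)\<^sup>2 - (zA r)\<^sup>2) / (s - r)
            + ((c s)\<^sup>2 - (c r)\<^sup>2) / (s - r)) + M \<mu> \<tau> K r * ((G s - G r) / (s - r))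
            + (J p s - J p r) / (s - r))
          \<longlongrightarrow> G s * (2 * m * zA' s - 2 * zA s * zA' s + 2 * c s * (zA' s - zP' s))
            + M \<mu> \<tau> K s * (- E p s * zA' s / (2 * (c s)\<^sup>2)) + zP' s * E p s) ?F"
        by (intro tendsto_intros q1 q2 q3 q4 q5 q6)
      \<comment> \<open>Since \<open>2 * (m - zP s) = M / c\<close>, the \<open>zA'\<close> terms
        cancel each other and the \<open>zP'\<close> term cancels the derivative of
        \<open>J p\<close>. This is the flow equation.\<close>
      moreover have "G s * (2 * m * zA' s - 2 * zA s * zA' s + 2 * c s * (zA' s - zP' s))
            + M \<mu> \<tau> K s * (- E p s * zA' s / (2 * (c s)\<^sup>2)) + zP' s * E p s = 0"
      proof -
        have "zA s = zP s + c s" by (simp add: c_def)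
        then show ?thesis using sI(3)
          by (simp add: G_def m_def field_simps power2_eq_square)
      qed
      moreover have "G s * (2 * m * ((zA s - zA r) / (s - r)) - ((zA s)\<^sup>2 - (zA r)\<^sup>2) / (s - r)
            + ((c s)\<^sup>2 - (c r)\<^sup>2) / (s - r)) + M \<mu> \<tau> K r * ((G s - G r) / (s - r))
            + (J p s - J p r) / (s - r) = g r / (s - r)" for r
        by (simp add: g_def b_def add_divide_distrib diff_divide_distrib distrib_left right_diff_distrib)
      ultimately have "((\<lambda>r. g r / (s - r)) \<longlongrightarrow> 0) ?F" by simp
      then show ?thesis using at_within_Icc_at_left[of p s] s by simp
    qed
    ultimately show "\<exists>g. (\<forall>r\<in>{p..<s}. W s - W r \<le> g r) \<and> ((\<lambda>r. g r / (s - r)) \<longlongrightarrow> 0) (at_left s)"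
      by blast
  qed
  then show ?thesis by (simp add: W_def G_def algebra_simps)
qed

text \<open>For \<open>sqrt K < c x\<close> the bound \<open>M \<mu> \<tau> K x / (2 * c x)\<close> is maximal at \<open>\<mu> x - zP x = sqrt K\<close>,
  where it equals \<open>sqrt K\<close>.\<close>

lemma loss_lower_bound:
  assumes K: "0 \<le> K" "\<tau> x + (\<mu> x - zP x)\<^sup>2 \<le> K" and \<tau>: "0 \<le> \<tau> x"
    and c: "0 < c x" and v: "0 \<le> v" "v \<le> c x" and M: "v \<le> M \<mu> \<tau> K x / (2 * c x)"
  shows "v\<^sup>2 \<le> K"
proof (rule ccontr)
  assume "\<not> v\<^sup>2 \<le> K"
  then have kv: "sqrt K < v" using v(1) by (simp add: real_less_lsqrt)
  define k \<delta> where "k = sqrt K" and "\<delta> = \<mu> x - zP x"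
  have kK: "k\<^sup>2 = K" "0 \<le> k" using K(1) by (auto simp: k_def)
  have "\<delta>\<^sup>2 \<le> k\<^sup>2" using K \<tau> kK by (auto simp: \<delta>_def)
  then have "\<bar>\<delta>\<bar> \<le> k" using kK(2) by (metis abs_le_square_iff abs_of_nonneg)
  then have dk: "\<delta> \<le> k" by simp
  \<comment> \<open>Here \<open>v \<le> c x\<close> enters: it puts every
    \<open>\<delta> \<le> k\<close> on the increasing branch of the parabola
    \<open>2 * c x * \<delta> - \<delta>^2\<close>.\<close>
  have kc: "k < c x" using kv v by (simp add: k_def)
  have "M \<mu> \<tau> K x \<le> k\<^sup>2 - \<delta>\<^sup>2 + 2 * c x * \<delta>" using M_eq[of K x] \<tau> kK by (simp add: \<delta>_def)
  also have "\<dots> = 2 * c x * k - (k - \<delta>) * (2 * c x - k - \<delta>)" by (simp add: power2_eq_square algebra_simps)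
  also have "\<dots> \<le> 2 * c x * k"
    using dk kc mult_nonneg_nonneg[of "k - \<delta>" "2 * c x - k - \<delta>"] by simp
  finally have "M \<mu> \<tau> K x / (2 * c x) \<le> k" using c by (simp add: field_simps)
  then show False using M kv by (simp add: k_def)
qed

end

end

section \<open>Optimality of the regional construction\<close>

context biased_interval
begin

lemma flow_deriv_at:
  assumes "regular p t" "\<And>s. s \<in> {p..t} \<Longrightarrow> f p = E p s * f s + J p s" "s \<in> {p<..<t}"
  shows "(f has_real_derivative zP' s * (f s / c s - 1)) (at s)"
  using flow_deriv[OF assms(1,2), of s] assms(3) at_within_Icc_at[of p s t] by auto

lemma flow_cont:
  assumes "regular p t" "\<And>s. s \<in> {p..t} \<Longrightarrow> f p = E p s * f s + J p s"
  shows "continuous_on {p..t} f"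
  by (rule DERIV_continuous_on[OF flow_deriv[OF assms]])

text \<open>Collects what both monotonicity cases must supply. Three pieces are glued: the agent's
  ideal action before \<open>\<theta>l\<close>, the flow up to \<open>\<theta>b\<close>, and one
  pooled lottery beyond. The principal's loss is \<open>c^2\<close> on the first, exactly
  \<open>(d \<theta>l)^2\<close> on the second, and at most that on the third.\<close>

lemma
  assumes \<theta>b: "\<theta>b \<in> {\<alpha>..\<beta>}" "zA \<theta>b = zP \<beta>" and \<theta>l: "\<theta>l \<in> {\<alpha>..\<theta>b}"
    and d_cont: "continuous_on {\<theta>l..\<theta>b} d"
    and d_deriv: "\<And>x. x \<in> {\<theta>l<..<\<theta>b} \<Longrightarrow> (d has_real_derivative zP' x * (d x / c x - 1)) (at x)"
    and c_pos: "\<And>x. x \<in> {\<theta>l<..<\<theta>b} \<Longrightarrow> 0 < c x"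
    and d_nonneg: "\<And>x. x \<in> {\<theta>l..\<theta>b} \<Longrightarrow> 0 \<le> d x"
    and d_end: "d \<theta>b = c \<theta>b / 2"
    and low: "\<theta>l \<noteq> \<alpha> \<Longrightarrow> d \<theta>l = c \<theta>l" "\<And>x. x \<in> {\<alpha>..<\<theta>l} \<Longrightarrow> \<bar>c x\<bar> \<le> d \<theta>l"
  shows construction_ic: "ic_on zA (pos_mean zP zA \<alpha> \<beta>) (pos_var zP zA \<alpha> \<beta>) {\<alpha>..\<beta>}"
    and construction_loss: "\<theta> \<in> {\<alpha>..\<beta>} \<Longrightarrow>
      pos_var zP zA \<alpha> \<beta> \<theta> + (pos_mean zP zA \<alpha> \<beta> \<theta> - zP \<theta>)\<^sup>2 \<le> pos_loss zP zA \<alpha> \<beta>"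
proof -
  let ?\<mu> = "pos_mean zP zA \<alpha> \<beta>" and ?\<tau> = "pos_var zP zA \<alpha> \<beta>"
  have ord: "\<alpha> \<le> \<theta>l" "\<theta>l \<le> \<theta>b" "\<theta>b \<le> \<beta>" using \<theta>b \<theta>l by auto
  have mid: "?\<mu> x = zP x + d x" "?\<tau> x = (d \<theta>l)\<^sup>2 - (d x)\<^sup>2" if "x \<in> {\<theta>l..\<theta>b}" for x
    using that by (auto simp: pos_mean_def pos_var_def Let_def)
  have left: "?\<mu> x = zA x" "?\<tau> x = 0" if "x \<in> {\<alpha>..<\<theta>l}" for x
    using that by (auto simp: pos_mean_def pos_var_def Let_def)
  have right: "?\<mu> x = (zP \<theta>b + zP \<beta>) / 2 \<and> ?\<tau> x = (d \<theta>l)\<^sup>2 - (c \<theta>b / 2)\<^sup>2" if x: "x \<in> {\<theta>b..\<beta>}" for x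
  proof (cases "x = \<theta>b")
    case True
    \<comment> \<open>The flow ends exactly at the pooled mean, so both formulas hold at
      \<open>\<theta>b\<close> and the pieces share that point.\<close>
    have "zP \<theta>b + c \<theta>b / 2 = (zP \<theta>b + zP \<beta>) / 2" unfolding c_def \<theta>b(2) by argo
    then show ?thesis unfolding True using mid[of \<theta>b] ord unfolding d_end by simp
  next
    case False
    then have "\<not> x < \<theta>l" "\<not> x \<le> \<theta>b" using x ord by auto
    then show ?thesis by (simp add: pos_mean_def pos_var_def Let_def c_def power_divide)
  qed
  have monoA_sub: "strict_mono_on {u..v} zA" if "\<alpha> \<le> u" "v \<le> \<beta>" for u v
    using monotone_on_subset[OF monoA, of "{u..v}"] that by auto
  have ic1: "ic_on zA ?\<mu> ?\<tau> {\<alpha>..\<theta>l}"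
  proof (cases "\<theta>l = \<alpha>")
    case True
    then show ?thesis by (simp add: ic_on_def)
  next
    case False
    \<comment> \<open>At \<open>\<theta>l\<close> itself \<open>d = c\<close> gives
      \<open>zP + d = zA\<close> with zero variance, so the flow joins full delegation without a
      jump.\<close>
    have eq: "?\<mu> x = zA x" "?\<tau> x = 0" if "x \<in> {\<alpha>..\<theta>l}" for x
      using that left[of x] mid[of \<theta>l] ord low(1)[OF False]
      by (cases "x = \<theta>l"; simp add: c_def)+
    show ?thesis unfolding ic_on_def using eq by auto
  qed
  have ic2: "ic_on zA ?\<mu> ?\<tau> {\<theta>l..\<theta>b}"
  proof -
    have sub: "{\<theta>l..\<theta>b} \<subseteq> {\<alpha>..\<beta>}" using ord by auto
    have dP: "(zP has_real_derivative zP' x) (at x)" if "x \<in> {\<theta>l<..<\<theta>b}" for x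
      using derivP[of x] at_within_Icc_at[of \<alpha> x \<beta>] that ord by auto
    have "ic_on zA (\<lambda>x. zP x + d x) (\<lambda>x. (d \<theta>l)\<^sup>2 - (d x)\<^sup>2) {\<theta>l..\<theta>b}"
    proof (rule ic_on_local[where \<mu>' = "\<lambda>x. zP' x * (d x / c x)"])
      show "continuous_on {\<theta>l..\<theta>b} (\<lambda>x. zP x + d x)"
        "continuous_on {\<theta>l..\<theta>b} (\<lambda>x. (d \<theta>l)\<^sup>2 - (d x)\<^sup>2)"
        by (intro continuous_intros d_cont continuous_on_subset[OF contP sub])+
      show "mono_on {\<theta>l..\<theta>b} zA"
        by (intro strict_mono_on_imp_mono_on monoA_sub ord)
      fix x assume x: "x \<in> {\<theta>l<..<\<theta>b}"
      show "((\<lambda>x. zP x + d x) has_real_derivative zP' x * (d x / c x)) (at x)"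
        by (rule derivative_eq_intros dP[OF x] d_deriv[OF x] refl)+ (simp add: algebra_simps)
      show "((\<lambda>x. (d \<theta>l)\<^sup>2 - (d x)\<^sup>2) has_real_derivative
          - 2 * (zP x + d x - zA x) * (zP' x * (d x / c x))) (at x)"
        by (rule derivative_eq_intros d_deriv[OF x] refl)+
          (use c_pos[OF x] in \<open>simp add: c_def field_simps\<close>)
      show "0 \<le> zP' x * (d x / c x)"
        using zP'_nonneg[of x] d_nonneg[of x] c_pos[OF x] x ord by auto
    qed
    then show ?thesis using ic_on_cong[of "{\<theta>l..\<theta>b}", OF mid] by simp
  qed
  have ic3: "ic_on zA ?\<mu> ?\<tau> {\<theta>b..\<beta>}"
    unfolding ic_on_def by (simp add: right[THEN conjunct1] right[THEN conjunct2])
  have "ic_on zA ?\<mu> ?\<tau> {\<alpha>..\<theta>b}"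
    by (rule ic_on_glue[OF ic1 ic2 monoA_sub]) (use ord in auto)
  then show "ic_on zA ?\<mu> ?\<tau> {\<alpha>..\<beta>}"
    by (rule ic_on_glue[OF _ ic3 monoA]) (use ord in auto)
  show "?\<tau> \<theta> + (?\<mu> \<theta> - zP \<theta>)\<^sup>2 \<le> pos_loss zP zA \<alpha> \<beta>" if \<theta>: "\<theta> \<in> {\<alpha>..\<beta>}"
  proof -
    consider "\<theta> \<in> {\<alpha>..<\<theta>l}" | "\<theta> \<in> {\<theta>l..\<theta>b}" | "\<theta> \<in> {\<theta>b..\<beta>}" using \<theta> by fastforce
    then show ?thesis
    proof cases
      case 1
      have "(c \<theta>)\<^sup>2 \<le> (d \<theta>l)\<^sup>2" using low(2)[OF 1] abs_le_square_iff[of "c \<theta>" "d \<theta>l"] by linarith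
      then show ?thesis using left[OF 1] by (simp add: pos_loss_def c_def)
    next
      case 2
      then show ?thesis using mid[OF 2] by (simp add: pos_loss_def)
    next
      case 3
      have "zP \<theta>b \<le> zP \<theta>" "zP \<theta> \<le> zP \<beta>" using zP_le[of \<theta>b \<theta>] zP_le[of \<theta> \<beta>] 3 \<theta>b by auto
      \<comment> \<open>Among the pooled types the two ends are farthest from the midpoint, and
        \<open>zP \<beta> - zP \<theta>b = c \<theta>b\<close>.\<close>
      then have "\<bar>(zP \<theta>b + zP \<beta>) / 2 - zP \<theta>\<bar> \<le> \<bar>c \<theta>b / 2\<bar>"
        using \<theta>b(2) by (simp add: c_def abs_le_iff field_simps)
      then have "((zP \<theta>b + zP \<beta>) / 2 - zP \<theta>)\<^sup>2 \<le> (c \<theta>b / 2)\<^sup>2" by (simp only: abs_le_square_iff)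
      then show ?thesis by (simp add: right[OF 3, THEN conjunct1] right[OF 3, THEN conjunct2] pos_loss_def)
    qed
  qed
qed

end

section \<open>Nonnegative bias growing from a zero at the left end\<close>

locale increasing_bias = biased_interval +
  assumes bias_mono: "mono_on {\<alpha>..\<beta>} (\<lambda>t. zA t - zP t)"
    and bias_zero: "zA \<alpha> = zP \<alpha>"
    and bias_pos: "\<And>t. t \<in> {\<alpha><..\<beta>} \<Longrightarrow> zP t < zA t"
begin

lemma c_mono: "s \<in> {\<alpha>..\<beta>} \<Longrightarrow> t \<in> {\<alpha>..\<beta>} \<Longrightarrow> s \<le> t \<Longrightarrow> c s \<le> c t"
  using bias_mono by (auto simp: c_def monotone_on_def)

lemma c_pos: "t \<in> {\<alpha><..\<beta>} \<Longrightarrow> 0 < c t"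
  using bias_pos by (simp add: c_def)

lemma c_nonneg: "t \<in> {\<alpha>..\<beta>} \<Longrightarrow> 0 \<le> c t"
  using c_pos[of t] bias_zero by (cases "t = \<alpha>") (auto simp: c_def)

lemma theta_bar_inc: "\<theta>b \<in> {\<alpha><..\<beta>}" "zA \<theta>b = zP \<beta>"
proof -
  have "zP \<alpha> < zP \<beta>" using strict_mono_onD[OF monoP, of \<alpha> \<beta>] \<alpha>\<beta> by simp
  moreover have "zP \<beta> < zA \<beta>" using bias_pos \<alpha>\<beta> by auto
  ultimately have "\<theta>b \<in> {\<alpha>..\<beta>}" "zA \<theta>b = zP \<beta>"
    using theta_bar bias_zero by auto
  moreover have "\<theta>b \<noteq> \<alpha>" using \<open>zP \<alpha> < zP \<beta>\<close> \<open>zA \<theta>b = zP \<beta>\<close> bias_zero by auto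
  ultimately show "\<theta>b \<in> {\<alpha><..\<beta>}" "zA \<theta>b = zP \<beta>" by auto
qed

lemma regular_inc: "p \<in> {\<alpha><..\<theta>b} \<Longrightarrow> regular p \<theta>b"
  using theta_bar_inc c_pos by (auto simp: regular_def)

lemma d_inc: "p \<in> {\<alpha><..\<theta>b} \<Longrightarrow> d p = c \<theta>b / 2 * E p \<theta>b + J p \<theta>b"
  using d_eq[of p] theta_bar_inc by auto

lemma d_theta_bar: "d \<theta>b = c \<theta>b / 2"
  using d_inc[of \<theta>b] theta_bar_inc by simp

lemma d_flow:
  assumes p: "p \<in> {\<alpha><..\<theta>b}" and s: "s \<in> {p..\<theta>b}"
  shows "d p = E p s * d s + J p s"
  using d_inc[OF p] d_inc[of s] E_mult[OF regular_inc[OF p] s] J_split[OF regular_inc[OF p] s] p s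
  by (simp add: algebra_simps)

lemma d_nonneg: "p \<in> {\<alpha><..\<theta>b} \<Longrightarrow> 0 \<le> d p"
  using d_inc[of p] J_nonneg[OF regular_inc] E_pos[of p \<theta>b] c_pos[OF theta_bar_inc(1)] by simp

text \<open>To the right of \<open>p\<close> the increasing \<open>c\<close> is at least
  \<open>c p\<close>, so the flow cannot climb above the level \<open>c p\<close> once it is below
  it.\<close>

lemma d_le_c_persists:
  assumes p: "p \<in> {\<alpha><..\<theta>b}" and dc: "d p \<le> c p" and s: "s \<in> {p..\<theta>b}"
  shows "d s \<le> c p"
proof -
  have reg: "regular p s" using regular_sub[OF regular_inc[OF p]] p s by auto
  have "c p * (1 - E p s) \<le> J p s"
    by (rule J_ge[OF reg]) (use p s theta_bar_inc c_mono in auto)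
  then have "E p s * d s \<le> E p s * c p"
    using d_flow[OF p s] dc by (simp add: algebra_simps)
  then show ?thesis using E_pos[of p s] by simp
qed

text \<open>The set defining \<open>\<theta>l\<close> must not accumulate at the zero \<alpha> of
  \<open>c\<close>. By persistence each member satisfies
  \<open>c \<theta> \<ge> d \<theta>b = c \<theta>b / 2\<close>, which keeps the set away from
  \<alpha>. So it is closed, its infimum is attained, and there \<open>d\<close> crosses
  \<open>c\<close>.\<close>

lemma theta_low_inc: "\<theta>l \<in> {\<alpha><..\<theta>b}" "d \<theta>l = c \<theta>l"
proof -
  define S where "S = {\<theta> \<in> {\<alpha>..\<theta>b}. zA \<theta> - zP \<theta> > 0 \<and> d \<theta> \<le> zA \<theta> - zP \<theta>}"
  have \<theta>l: "\<theta>l = Inf S" by (simp add: theta_low_def S_def)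
  have cb: "0 < c \<theta>b" using c_pos theta_bar_inc by auto
  have S_pos: "\<theta> \<in> {\<alpha><..\<theta>b}" if "\<theta> \<in> S" for \<theta>
    using that bias_zero by (cases "\<theta> = \<alpha>") (auto simp: S_def)
  have S_c: "c \<theta>b / 2 \<le> c \<theta>" if "\<theta> \<in> S" for \<theta>
    using d_le_c_persists[OF S_pos[OF that], of \<theta>b] that d_theta_bar by (auto simp: S_def c_def)
  \<comment> \<open>Any positive level below \<open>c \<theta>b / 2\<close> would serve: it places
    \<open>\<eta>\<close> strictly to the left of \<open>S\<close> and strictly to the right of
    \<alpha>.\<close>
  obtain \<eta> where \<eta>: "\<alpha> \<le> \<eta>" "\<eta> \<le> \<theta>b" "c \<eta> = c \<theta>b / 4"
    using IVT'[of c \<alpha> "c \<theta>b / 4" \<theta>b] cb bias_zero theta_bar_inc continuous_on_subset[OF contc]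
    by (auto simp: c_def)
  have "\<eta> \<noteq> \<alpha>" using \<eta>(3) cb bias_zero by (auto simp: c_def)
  then have \<eta>I: "\<eta> \<in> {\<alpha><..\<theta>b}" using \<eta> by auto
  have S_low: "\<eta> < \<theta>" if "\<theta> \<in> S" for \<theta>
  proof (rule ccontr)
    assume "\<not> \<eta> < \<theta>"
    then have "c \<theta> \<le> c \<eta>" using c_mono[of \<theta> \<eta>] S_pos[OF that] \<eta> theta_bar_inc by auto
    then show False using S_c[OF that] \<eta>(3) cb by simp
  qed
  have reg: "regular \<eta> \<theta>b" by (rule regular_inc[OF \<eta>I])
  have contdc: "continuous_on {\<eta>..\<theta>b} (\<lambda>\<theta>. d \<theta> - c \<theta>)"
    using \<eta> theta_bar_inc
    by (intro continuous_intros flow_cont[OF reg d_flow[OF \<eta>I]] continuous_on_subset[OF contc]) auto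
  have S_eq: "S = {\<eta>..\<theta>b} \<inter> (\<lambda>\<theta>. d \<theta> - c \<theta>) -` {..0}"
  proof
    show "S \<subseteq> {\<eta>..\<theta>b} \<inter> (\<lambda>\<theta>. d \<theta> - c \<theta>) -` {..0}"
      using S_low by (force simp: S_def c_def)
    show "{\<eta>..\<theta>b} \<inter> (\<lambda>\<theta>. d \<theta> - c \<theta>) -` {..0} \<subseteq> S"
    proof
      fix \<theta> assume \<theta>: "\<theta> \<in> {\<eta>..\<theta>b} \<inter> (\<lambda>\<theta>. d \<theta> - c \<theta>) -` {..0}"
      then have "0 < c \<theta>" using c_pos[of \<theta>] \<eta>I theta_bar_inc by auto
      then show "\<theta> \<in> S" using \<theta> \<eta>I by (auto simp: S_def c_def)
    qed
  qed
  have closed: "closed S" unfolding S_eq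
    by (rule continuous_closed_preimage[OF contdc]) auto
  have "\<theta>b \<in> S" using cb theta_bar_inc d_theta_bar by (auto simp: S_def c_def)
  moreover have bdd: "bdd_below S" by (auto simp: S_def intro!: bdd_belowI[of _ \<alpha>])
  ultimately have lS: "\<theta>l \<in> S" unfolding \<theta>l using closed by (intro closed_contains_Inf) auto
  show "\<theta>l \<in> {\<alpha><..\<theta>b}" by (rule S_pos[OF lS])
  have "\<eta> \<notin> S" using S_low by blast
  then have "c \<eta> \<le> d \<eta>" using \<eta>I c_pos[of \<eta>] theta_bar_inc by (auto simp: S_def c_def)
  moreover have "d \<theta>l \<le> c \<theta>l" using lS by (auto simp: S_def c_def)
  \<comment> \<open>An intermediate zero of \<open>d - c\<close> again belongs to \<open>S\<close>,
    so minimality forces it to be \<open>\<theta>l\<close>.\<close>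
  ultimately obtain x where x: "\<eta> \<le> x" "x \<le> \<theta>l" "d x - c x = 0"
    using IVT2'[of "\<lambda>\<theta>. d \<theta> - c \<theta>" \<theta>l 0 \<eta>] S_low[OF lS] lS
      continuous_on_subset[OF contdc, of "{\<eta>..\<theta>l}"] by (auto simp: S_def)
  then have "x \<in> S" using lS by (auto simp: S_eq)
  then have "\<theta>l \<le> x" unfolding \<theta>l by (rule cInf_lower[OF _ bdd])
  then show "d \<theta>l = c \<theta>l" using x by auto
qed

lemma minimax_inc:
  "minimax_on zP zA \<alpha> \<beta> (pos_mean zP zA \<alpha> \<beta>) (pos_var zP zA \<alpha> \<beta>) (pos_loss zP zA \<alpha> \<beta>)"
  unfolding minimax_on_def
proof (intro conjI ballI allI impI)
  note l = theta_low_inc and b = theta_bar_inc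
  have reg: "regular \<theta>l \<theta>b" by (rule regular_inc[OF l(1)])
  have flow: "d \<theta>l = E \<theta>l s * d s + J \<theta>l s" if "s \<in> {\<theta>l..\<theta>b}" for s
    by (rule d_flow[OF l(1) that])
  have low: "\<bar>c x\<bar> \<le> d \<theta>l" if "x \<in> {\<alpha>..<\<theta>l}" for x
    using c_mono[of x \<theta>l] c_nonneg[of x] that l b by auto
  have \<theta>b': "\<theta>b \<in> {\<alpha>..\<beta>}" "\<theta>l \<in> {\<alpha>..\<theta>b}" using l b by auto
  have pos: "0 < c x" if "x \<in> {\<theta>l<..<\<theta>b}" for x using c_pos[of x] that l b by auto
  have nonneg: "0 \<le> d x" if "x \<in> {\<theta>l..\<theta>b}" for x using d_nonneg[of x] that l by auto
  show "ic_on zA (pos_mean zP zA \<alpha> \<beta>) (pos_var zP zA \<alpha> \<beta>) {\<alpha>..\<beta>}"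
    by (rule construction_ic[OF \<theta>b'(1) b(2) \<theta>b'(2) flow_cont[OF reg flow]
          flow_deriv_at[OF reg flow] pos nonneg d_theta_bar l(2) low])
  show "pos_var zP zA \<alpha> \<beta> \<theta> + (pos_mean zP zA \<alpha> \<beta> \<theta> - zP \<theta>)\<^sup>2 \<le> pos_loss zP zA \<alpha> \<beta>"
    if "\<theta> \<in> {\<alpha>..\<beta>}" for \<theta>
    by (rule construction_loss[OF \<theta>b'(1) b(2) \<theta>b'(2) flow_cont[OF reg flow]
          flow_deriv_at[OF reg flow] pos nonneg d_theta_bar l(2) low that])
  fix \<mu> \<tau> B K
  assume ic: "ic_on zA \<mu> \<tau> {\<alpha>..\<beta>}"
    and "\<forall>\<theta>\<in>{\<alpha>..\<beta>}. \<bar>\<mu> \<theta>\<bar> \<le> B \<and> 0 \<le> \<tau> \<theta>" and K: "\<forall>\<theta>\<in>{\<alpha>..\<beta>}. \<tau> \<theta> + (\<mu> \<theta> - zP \<theta>)\<^sup>2 \<le> K"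
  then have B: "\<And>\<theta>. \<theta> \<in> {\<alpha>..\<beta>} \<Longrightarrow> \<bar>\<mu> \<theta>\<bar> \<le> B" and \<tau>: "\<And>\<theta>. \<theta> \<in> {\<alpha>..\<beta>} \<Longrightarrow> 0 \<le> \<tau> \<theta>" by auto
  \<comment> \<open>The choice \<open>zA \<theta>b = zP \<beta>\<close> makes the agent's loss of
    \<open>\<theta>b\<close> from reporting \<beta> equal to the principal's loss at \<beta>, which
    \<open>K\<close> bounds.\<close>
  have "\<tau> \<theta>b + (\<mu> \<theta>b - zA \<theta>b)\<^sup>2 \<le> \<tau> \<beta> + (\<mu> \<beta> - zP \<beta>)\<^sup>2"
    using ic_onD[OF ic \<theta>b'(1), of \<beta>] b(2) \<alpha>\<beta> by simp
  also have "\<dots> \<le> K" using K \<alpha>\<beta> by simp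
  finally have "(c \<theta>b)\<^sup>2 \<le> M \<mu> \<tau> K \<theta>b" by (simp add: M_def)
  then have "c \<theta>b / 2 \<le> M \<mu> \<tau> K \<theta>b / (2 * c \<theta>b)"
    using c_pos[OF b(1)] by (simp add: field_simps power2_eq_square)
  then have "c \<theta>b / 2 * E \<theta>l \<theta>b \<le> E \<theta>l \<theta>b * (M \<mu> \<tau> K \<theta>b / (2 * c \<theta>b))"
    using E_pos[of \<theta>l \<theta>b] by (simp only: mult.commute[of _ "E \<theta>l \<theta>b"] mult_le_cancel_left_pos)
  then have "d \<theta>l \<le> M \<mu> \<tau> K \<theta>l / (2 * c \<theta>l)"
    using supersolution[OF ic B reg, of K] K d_inc[OF l(1)] by simp
  moreover have "0 \<le> K" using K \<tau>[of \<alpha>] \<alpha>\<beta> by (meson add_nonneg_nonneg atLeastAtMost_iff less_imp_le order.refl order_trans zero_le_power2)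
  ultimately show "pos_loss zP zA \<alpha> \<beta> \<le> K"
    unfolding pos_loss_def
    by (intro loss_lower_bound[OF ic B])
      (use l b c_pos[of \<theta>l] d_nonneg[OF l(1)] K \<tau> in auto)
qed

text \<open>The crossing type lies strictly before \<open>\<theta>l\<close>. Both regions therefore
  give it the same noiseless action and match without any correction.\<close>

lemma endpoint_inc: "pos_mean zP zA \<alpha> \<beta> \<alpha> = zA \<alpha>" "pos_var zP zA \<alpha> \<beta> \<alpha> = 0"
  using theta_low_inc by (auto simp: pos_mean_def pos_var_def Let_def)

end

section \<open>Nonnegative bias shrinking to a zero at the right end\<close>

locale decreasing_bias = biased_interval +
  assumes bias_antimono: "antimono_on {\<alpha>..\<beta>} (\<lambda>t. zA t - zP t)"
    and bias_zero: "zA \<beta> = zP \<beta>"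
    and bias_pos: "\<And>t. t \<in> {\<alpha>..<\<beta>} \<Longrightarrow> zP t < zA t"
begin

lemma c_antimono: "s \<in> {\<alpha>..\<beta>} \<Longrightarrow> t \<in> {\<alpha>..\<beta>} \<Longrightarrow> s \<le> t \<Longrightarrow> c t \<le> c s"
  using bias_antimono by (auto simp: c_def monotone_on_def)

lemma c_pos: "t \<in> {\<alpha>..<\<beta>} \<Longrightarrow> 0 < c t"
  using bias_pos by (simp add: c_def)

lemma theta_bar_dec: "\<theta>b = \<beta>"
proof -
  have "zA \<alpha> < zA \<beta>" using strict_mono_onD[OF monoA, of \<alpha> \<beta>] \<alpha>\<beta> by simp
  then have "\<theta>b \<in> {\<alpha>..\<beta>}" "zA \<theta>b = zA \<beta>" using theta_bar bias_zero by auto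
  then show ?thesis
    using strict_mono_on_imp_inj_on[OF monoA] \<alpha>\<beta> by (auto dest: inj_onD)
qed

lemma regular_dec: "p \<in> {\<alpha>..t} \<Longrightarrow> t < \<beta> \<Longrightarrow> regular p t"
  using c_pos by (auto simp: regular_def)

text \<open>The exponent in \<open>E p\<close> may diverge at \<beta>, but before \<beta> the
  function \<open>E p\<close> is positive and decreasing. A monotone factor preserves integrability,
  by the second mean value theorem.\<close>

lemma integrable_zP'E:
  assumes p: "p \<in> {\<alpha>..<\<beta>}"
  shows "(\<lambda>s. zP' s * E p s) integrable_on {p..\<beta>}"
proof -
  \<comment> \<open>The value 0 keeps \<open>g\<close> increasing up to \<beta>, whatever
    \<open>E p \<beta>\<close> evaluates to.\<close>
  define g where "g s = (if s < \<beta> then - E p s else 0)" for s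
  have g: "g u \<le> g v" if uv: "p \<le> u" "u \<le> v" "v \<le> \<beta>" for u v
  proof (cases "v < \<beta>")
    case True
    then show ?thesis
      using E_antimono[OF regular_dec[of p v], of u v] p uv by (auto simp: g_def)
  qed (use E_pos[of p u] in \<open>auto simp: g_def\<close>)
  have P': "zP' integrable_on {p..\<beta>}"
    by (intro integrable_continuous_real continuous_on_subset[OF contP']) (use p in auto)
  have "p \<le> \<beta>" using p by auto
  then have "(\<lambda>s. g s * zP' s) integrable_on {p..\<beta>}"
    using second_mean_value_theorem_full[OF P', of g] g by (metis integrable_on_def)
  then have "(\<lambda>s. - (g s * zP' s)) integrable_on {p..\<beta>}" by (rule integrable_neg)
  then show ?thesis
    by (rule integrable_spike_finite[of "{\<beta>}", rotated 2]) (auto simp: g_def)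
qed

text \<open>The factor \<open>c \<beta> = 0\<close> removes the boundary term, even if its exponent
  is not integrable.\<close>

lemma d_dec: "p \<in> {\<alpha>..\<beta>} \<Longrightarrow> d p = J p \<beta>"
  using d_eq[of p] theta_bar_dec bias_zero \<alpha>\<beta> by (simp add: c_def)

lemma d_beta: "d \<beta> = 0"
  using d_dec[of \<beta>] \<alpha>\<beta> by simp

lemma d_flow:
  assumes p: "p \<in> {\<alpha>..s}" and s: "s < \<beta>"
  shows "d p = E p s * d s + J p s"
proof -
  have "J p \<beta> = J p s + E p s * J s \<beta>"
    by (rule J_split_integrable[OF regular_dec[OF p s]])
      (use p s in \<open>auto intro!: regular_dec integrable_zP'E\<close>)
  then show ?thesis using d_dec[of p] d_dec[of s] p s by auto
qed

lemma J_cont: "p \<in> {\<alpha>..<\<beta>} \<Longrightarrow> continuous_on {p..\<beta>} (J p)"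
  unfolding J_def by (rule indefinite_integral_continuous_1[OF integrable_zP'E])

lemma d_nonneg: "p \<in> {\<alpha>..\<beta>} \<Longrightarrow> 0 \<le> d p"
proof (cases "p = \<beta>")
  case False
  assume p: "p \<in> {\<alpha>..\<beta>}"
  have "0 \<le> J p \<beta>" unfolding J_def
    using p False zP'_nonneg E_pos[THEN less_imp_le]
    by (intro integral_nonneg integrable_zP'E mult_nonneg_nonneg) auto
  then show ?thesis using d_dec[OF p] by simp
qed (simp add: d_beta)

text \<open>As \<open>c\<close> decreases, \<open>c p\<close> bounds it on the whole rest of the
  interval, so \<open>J p t \<le> c p * (1 - E p t)\<close> for \<open>t < \<beta>\<close>, and a
  limit gives the claim. In particular \<open>\<theta>l\<close> is the left end.\<close>

lemma d_le_c: "p \<in> {\<alpha>..\<beta>} \<Longrightarrow> d p \<le> c p"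
proof (cases "p = \<beta>")
  case False
  assume "p \<in> {\<alpha>..\<beta>}"
  then have p: "p \<in> {\<alpha>..<\<beta>}" using False by auto
  have "J p \<beta> \<le> c p"
  proof (rule continuous_on_Icc_le[OF _ J_cont[OF p], where g = "\<lambda>_. c p"])
    fix t assume t: "t \<in> {p..<\<beta>}"
    have "J p t \<le> c p * (1 - E p t)"
      by (rule J_le[OF regular_dec]) (use t p c_antimono in auto)
    also have "\<dots> \<le> c p" using c_pos[OF p] E_pos[of p t] by (simp add: algebra_simps)
    finally show "J p t \<le> c p" .
  qed (use p in auto)
  then show ?thesis using d_dec p by simp
qed (simp add: d_beta c_def bias_zero)

text \<open>At \<beta> the flow equation is singular; there \<open>d\<close> is squeezed between 0
  and \<open>c\<close>.\<close>

lemma d_cont: "continuous_on {\<alpha>..\<beta>} d"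
  unfolding continuous_on_def
proof
  fix x assume x: "x \<in> {\<alpha>..\<beta>}"
  show "(d \<longlongrightarrow> d x) (at x within {\<alpha>..\<beta>})"
  proof (cases "x = \<beta>")
    case True
    have "c \<beta> = 0" by (simp add: c_def bias_zero)
    then have "(c \<longlongrightarrow> 0) (at \<beta> within {\<alpha>..\<beta>})"
      using contc \<alpha>\<beta> by (auto simp: continuous_on_def dest!: bspec[of _ _ \<beta>])
    then have "(d \<longlongrightarrow> 0) (at \<beta> within {\<alpha>..\<beta>})"
      by (rule tendsto_sandwich[rotated 2, OF tendsto_const])
        (auto simp: eventually_at_filter d_nonneg d_le_c)
    then show ?thesis using True d_beta by simp
  next
    case False
    define t where "t = (x + \<beta>) / 2"
    have t: "x < t" "t < \<beta>" "\<alpha> \<le> t" using x False by (auto simp: t_def)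
    have "continuous_on {\<alpha>..t} d"
      by (rule flow_cont[OF regular_dec d_flow]) (use t in auto)
    then have "(d \<longlongrightarrow> d x) (at x within {\<alpha>..t})" using x t by (simp add: continuous_on_def)
    moreover have "at x within {\<alpha>..t} = at x within {\<alpha>..\<beta>}"
      by (rule at_within_nhd[of _ "{..<t}"]) (use t in auto)
    ultimately show ?thesis by simp
  qed
qed

lemma theta_low_dec: "\<theta>l = \<alpha>"
  unfolding theta_low_def theta_bar_dec
  by (rule cInf_eq_minimum) (use \<alpha>\<beta> bias_pos[of \<alpha>] d_le_c[of \<alpha>] in \<open>auto simp: c_def\<close>)

text \<open>At \<beta> the quotient \<open>M / (2 * c)\<close> has no value from which the
  comparison could start. Its sign near \<beta> suffices: the nonnegative term is dropped from the
  supersolution inequality, and the remaining \<open>J \<alpha> t\<close> tends to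
  \<open>d \<alpha>\<close>.\<close>

lemma minimax_dec:
  "minimax_on zP zA \<alpha> \<beta> (pos_mean zP zA \<alpha> \<beta>) (pos_var zP zA \<alpha> \<beta>) (pos_loss zP zA \<alpha> \<beta>)"
  unfolding minimax_on_def
proof (intro conjI ballI allI impI)
  have deriv: "(d has_real_derivative zP' x * (d x / c x - 1)) (at x)" if "x \<in> {\<alpha><..<\<beta>}" for x
    by (rule flow_deriv_at[of \<alpha> "(x + \<beta>) / 2", OF regular_dec d_flow]) (use that in auto)
  have constr: "\<theta>b \<in> {\<alpha>..\<beta>}" "zA \<theta>b = zP \<beta>" "\<theta>l \<in> {\<alpha>..\<theta>b}" "continuous_on {\<theta>l..\<theta>b} d"
    "\<And>x. x \<in> {\<theta>l<..<\<theta>b} \<Longrightarrow> (d has_real_derivative zP' x * (d x / c x - 1)) (at x)"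
    "\<And>x. x \<in> {\<theta>l<..<\<theta>b} \<Longrightarrow> 0 < c x" "\<And>x. x \<in> {\<theta>l..\<theta>b} \<Longrightarrow> 0 \<le> d x"
    "d \<theta>b = c \<theta>b / 2" "\<theta>l \<noteq> \<alpha> \<Longrightarrow> d \<theta>l = c \<theta>l" "\<And>x. x \<in> {\<alpha>..<\<theta>l} \<Longrightarrow> \<bar>c x\<bar> \<le> d \<theta>l"
    unfolding theta_bar_dec theta_low_dec
    using \<alpha>\<beta> bias_zero d_cont d_beta deriv d_nonneg c_pos by (auto simp: c_def)
  show "ic_on zA (pos_mean zP zA \<alpha> \<beta>) (pos_var zP zA \<alpha> \<beta>) {\<alpha>..\<beta>}"
    by (rule construction_ic[OF constr])
  show "pos_var zP zA \<alpha> \<beta> \<theta> + (pos_mean zP zA \<alpha> \<beta> \<theta> - zP \<theta>)\<^sup>2 \<le> pos_loss zP zA \<alpha> \<beta>"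
    if "\<theta> \<in> {\<alpha>..\<beta>}" for \<theta>
    by (rule construction_loss[OF constr that])
  fix \<mu> \<tau> B K
  assume ic: "ic_on zA \<mu> \<tau> {\<alpha>..\<beta>}"
    and "\<forall>\<theta>\<in>{\<alpha>..\<beta>}. \<bar>\<mu> \<theta>\<bar> \<le> B \<and> 0 \<le> \<tau> \<theta>" and K: "\<forall>\<theta>\<in>{\<alpha>..\<beta>}. \<tau> \<theta> + (\<mu> \<theta> - zP \<theta>)\<^sup>2 \<le> K"
  then have B: "\<And>\<theta>. \<theta> \<in> {\<alpha>..\<beta>} \<Longrightarrow> \<bar>\<mu> \<theta>\<bar> \<le> B" and \<tau>: "\<And>\<theta>. \<theta> \<in> {\<alpha>..\<beta>} \<Longrightarrow> 0 \<le> \<tau> \<theta>" by auto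
  have K0: "0 \<le> K"
    using K \<tau>[of \<alpha>] \<alpha>\<beta> by (meson add_nonneg_nonneg atLeastAtMost_iff less_imp_le order.refl order_trans zero_le_power2)
  have a: "\<alpha> \<in> {\<alpha>..<\<beta>}" using \<alpha>\<beta> by simp
  have "(d \<alpha>)\<^sup>2 \<le> L" if KL: "K < L" for L
    \<comment> \<open>The slack \<open>L - K\<close> keeps \<open>M / (2 * c)\<close> positive near the zero \<open>\<beta>\<close> of \<open>c\<close>.\<close>
  proof -
    let ?M = "M \<mu> \<tau> L"
    have L: "\<tau> \<theta> + (\<mu> \<theta> - zP \<theta>)\<^sup>2 \<le> L" if "\<theta> \<in> {\<alpha>..\<beta>}" for \<theta> using K that KL by force
    have "c \<beta> = 0" by (simp add: c_def bias_zero)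
    then have "0 < ?M \<beta>" using M_eq[OF ic B, of L \<beta>] K[rule_format, of \<beta>] KL \<alpha>\<beta> by simp
    moreover have "(?M \<longlongrightarrow> ?M \<beta>) (at_left \<beta>)"
      using continuous_on_Icc_at_leftD[OF M_continuous[OF ic B] \<alpha>\<beta>] .
    ultimately have "\<forall>\<^sub>F t in at_left \<beta>. 0 < ?M t" by (rule order_tendstoD(1)[rotated])
    moreover have "\<forall>\<^sub>F t in at_left \<beta>. t \<in> {\<alpha><..<\<beta>}"
      using eventually_at_leftI[of \<alpha> \<beta> "\<lambda>t. t \<in> {\<alpha><..<\<beta>}", OF _ \<alpha>\<beta>] by simp
    ultimately have "\<forall>\<^sub>F t in at_left \<beta>. 0 < ?M t \<and> t \<in> {\<alpha><..<\<beta>}" by (rule eventually_conj)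
    then have "\<forall>\<^sub>F t in at_left \<beta>. J \<alpha> t \<le> ?M \<alpha> / (2 * c \<alpha>)"
    proof (rule eventually_mono)
      fix t assume t: "0 < ?M t \<and> t \<in> {\<alpha><..<\<beta>}"
      have reg: "regular \<alpha> t" using regular_dec t by auto
      have "0 \<le> E \<alpha> t * (?M t / (2 * c t))"
        using t c_pos[of t] E_pos[of \<alpha> t] by auto
      then show "J \<alpha> t \<le> ?M \<alpha> / (2 * c \<alpha>)" using supersolution[OF ic B reg L] by simp
    qed
    moreover have "(J \<alpha> \<longlongrightarrow> J \<alpha> \<beta>) (at_left \<beta>)"
      by (rule continuous_on_Icc_at_leftD[OF J_cont[OF a] \<alpha>\<beta>])
    ultimately have "J \<alpha> \<beta> \<le> ?M \<alpha> / (2 * c \<alpha>)"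
      by (intro tendsto_upperbound) auto
    then have "d \<alpha> \<le> ?M \<alpha> / (2 * c \<alpha>)" using d_dec[of \<alpha>] \<alpha>\<beta> by simp
    then show ?thesis
      by (intro loss_lower_bound[OF ic B])
        (use \<alpha>\<beta> K0 KL L \<tau> c_pos[OF a] d_nonneg[of \<alpha>] d_le_c[of \<alpha>] in auto)
  qed
  then show "pos_loss zP zA \<alpha> \<beta> \<le> K"
    unfolding pos_loss_def theta_low_dec by (rule dense_ge)
qed

text \<open>At the crossing point the mean is the common ideal action, so the variance is the entire
  regional loss. Two regions with different losses disagree there until the smaller variance is
  raised; this is the origin of the added constants in \<open>star_var_dec\<close>.\<close>

lemma endpoint_dec:
  "pos_mean zP zA \<alpha> \<beta> \<beta> = zP \<beta>" "pos_var zP zA \<alpha> \<beta> \<beta> = pos_loss zP zA \<alpha> \<beta>"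
  using \<alpha>\<beta> d_beta
  by (auto simp: pos_mean_def pos_var_def pos_loss_def Let_def theta_bar_dec theta_low_dec)

end

section \<open>The two regions\<close>

lemma C1_on_Icc_subset:
  assumes "C1_on_Icc a b f" "a \<le> \<alpha>" "\<beta> \<le> b"
  shows "C1_on_Icc \<alpha> \<beta> f"
proof -
  obtain f' where f': "\<forall>x\<in>{a..b}. (f has_real_derivative f' x) (at x within {a..b})"
    "continuous_on {a..b} f'"
    using assms(1) by (auto simp: C1_on_Icc_def)
  have sub: "{\<alpha>..\<beta>} \<subseteq> {a..b}" using assms by auto
  show ?thesis unfolding C1_on_Icc_def
    using f' sub by (intro exI[of _ f'] conjI ballI DERIV_subset[OF _ sub] continuous_on_subset[OF _ sub]) auto
qed

lemma C1_on_Icc_reflect: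
  assumes "C1_on_Icc \<alpha> \<beta> f"
  shows "C1_on_Icc \<alpha> \<beta> (reflect \<kappa> \<alpha> \<beta> f)"
proof -
  obtain f' where f': "\<And>x. x \<in> {\<alpha>..\<beta>} \<Longrightarrow> (f has_real_derivative f' x) (at x within {\<alpha>..\<beta>})"
    and cont: "continuous_on {\<alpha>..\<beta>} f'"
    using assms unfolding C1_on_Icc_def by blast
  have "(reflect \<kappa> \<alpha> \<beta> f has_real_derivative f' (\<alpha> + \<beta> - x)) (at x within {\<alpha>..\<beta>})"
    if x: "x \<in> {\<alpha>..\<beta>}" for x
  proof -
    have im: "(\<lambda>x. \<alpha> + \<beta> - x) ` {\<alpha>..\<beta>} = {\<alpha>..\<beta>}"
      by (auto simp: image_iff intro!: bexI[of _ "\<alpha> + \<beta> - _"])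
    have "(f \<circ> (\<lambda>x. \<alpha> + \<beta> - x) has_real_derivative f' (\<alpha> + \<beta> - x) * (- 1)) (at x within {\<alpha>..\<beta>})"
    proof (rule DERIV_image_chain)
      show "(f has_real_derivative f' (\<alpha> + \<beta> - x)) (at (\<alpha> + \<beta> - x) within (\<lambda>x. \<alpha> + \<beta> - x) ` {\<alpha>..\<beta>})"
        unfolding im by (rule f') (use x in auto)
    qed (auto intro!: derivative_eq_intros)
    then show ?thesis unfolding reflect_def o_def by (auto intro!: derivative_eq_intros)
  qed
  moreover have "continuous_on {\<alpha>..\<beta>} (\<lambda>x. f' (\<alpha> + \<beta> - x))"
    by (rule continuous_on_compose2[OF cont]) (auto intro!: continuous_intros)
  ultimately show ?thesis unfolding C1_on_Icc_def
    by (intro exI[of _ "\<lambda>x. f' (\<alpha> + \<beta> - x)"] conjI ballI)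
qed

lemma strict_mono_on_reflect:
  assumes "strict_mono_on {\<alpha>..\<beta>} f"
  shows "strict_mono_on {\<alpha>..\<beta>} (reflect \<kappa> \<alpha> \<beta> f)"
  by (rule strict_mono_onI) (auto simp: reflect_def intro!: strict_mono_onD[OF assms])

lemma biased_intervalI:
  assumes "\<alpha> < \<beta>" "C1_on_Icc \<alpha> \<beta> zP" "C1_on_Icc \<alpha> \<beta> zA"
    "strict_mono_on {\<alpha>..\<beta>} zP" "strict_mono_on {\<alpha>..\<beta>} zA"
  obtains zP' zA' where "biased_interval zP zA zP' zA' \<alpha> \<beta>"
proof -
  obtain zP' zA' where
    "\<forall>x\<in>{\<alpha>..\<beta>}. (zP has_real_derivative zP' x) (at x within {\<alpha>..\<beta>})" "continuous_on {\<alpha>..\<beta>} zP'"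
    "\<forall>x\<in>{\<alpha>..\<beta>}. (zA has_real_derivative zA' x) (at x within {\<alpha>..\<beta>})"
    using assms(2,3) unfolding C1_on_Icc_def by blast
  then have "biased_interval zP zA zP' zA' \<alpha> \<beta>"
    using assms by unfold_locales auto
  then show thesis by (rule that)
qed

locale regional_problem =
  fixes yP yA :: "real \<Rightarrow> real" and \<alpha> \<beta> :: real
  assumes \<alpha>\<beta>: "\<alpha> < \<beta>"
    and C1: "C1_on_Icc \<alpha> \<beta> yP" "C1_on_Icc \<alpha> \<beta> yA"
    and mono: "strict_mono_on {\<alpha>..\<beta>} yP" "strict_mono_on {\<alpha>..\<beta>} yA"
begin

abbreviation "\<kappa> \<equiv> yP \<alpha> + yP \<beta>"
abbreviation "rP \<equiv> reflect \<kappa> \<alpha> \<beta> yP"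
abbreviation "rA \<equiv> reflect \<kappa> \<alpha> \<beta> yA"

lemma reg_pos:
  assumes "nonneg_bias yP yA \<alpha> \<beta>"
  shows "reg_mean yP yA \<alpha> \<beta> = pos_mean yP yA \<alpha> \<beta>" "reg_var yP yA \<alpha> \<beta> = pos_var yP yA \<alpha> \<beta>"
    "reg_loss yP yA \<alpha> \<beta> = pos_loss yP yA \<alpha> \<beta>"
  using assms by (auto simp: reg_mean_def reg_var_def reg_loss_def)

lemma reg_neg:
  assumes "\<not> nonneg_bias yP yA \<alpha> \<beta>"
  shows "reg_mean yP yA \<alpha> \<beta> = reflect \<kappa> \<alpha> \<beta> (pos_mean rP rA \<alpha> \<beta>)"
    "reg_var yP yA \<alpha> \<beta> = (\<lambda>\<theta>. pos_var rP rA \<alpha> \<beta> (\<alpha> + \<beta> - \<theta>))"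
    "reg_loss yP yA \<alpha> \<beta> = pos_loss rP rA \<alpha> \<beta>"
  using assms by (auto simp: reg_mean_def reg_var_def reg_loss_def Let_def reflect_def)

lemma reflected: "regional_problem rP rA \<alpha> \<beta>"
  by unfold_locales (intro \<alpha>\<beta> C1_on_Icc_reflect C1 strict_mono_on_reflect mono)+

lemma minimax_increasing_pos:
  assumes "mono_on {\<alpha>..\<beta>} (\<lambda>t. yA t - yP t)" "yA \<alpha> = yP \<alpha>" "\<And>t. t \<in> {\<alpha><..\<beta>} \<Longrightarrow> yP t < yA t"
  shows "minimax_on yP yA \<alpha> \<beta> (pos_mean yP yA \<alpha> \<beta>) (pos_var yP yA \<alpha> \<beta>) (pos_loss yP yA \<alpha> \<beta>)"
    "pos_mean yP yA \<alpha> \<beta> \<alpha> = yA \<alpha>" "pos_var yP yA \<alpha> \<beta> \<alpha> = 0"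
proof -
  obtain zP' zA' where "biased_interval yP yA zP' zA' \<alpha> \<beta>"
    using biased_intervalI[OF \<alpha>\<beta> C1 mono] .
  then interpret increasing_bias yP yA zP' zA' \<alpha> \<beta>
    using assms by (simp add: increasing_bias_def increasing_bias_axioms_def)
  show "minimax_on yP yA \<alpha> \<beta> (pos_mean yP yA \<alpha> \<beta>) (pos_var yP yA \<alpha> \<beta>) (pos_loss yP yA \<alpha> \<beta>)"
    "pos_mean yP yA \<alpha> \<beta> \<alpha> = yA \<alpha>" "pos_var yP yA \<alpha> \<beta> \<alpha> = 0"
    by (fact minimax_inc endpoint_inc)+
qed

lemma minimax_decreasing_pos:
  assumes "antimono_on {\<alpha>..\<beta>} (\<lambda>t. yA t - yP t)" "yA \<beta> = yP \<beta>" "\<And>t. t \<in> {\<alpha>..<\<beta>} \<Longrightarrow> yP t < yA t"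
  shows "minimax_on yP yA \<alpha> \<beta> (pos_mean yP yA \<alpha> \<beta>) (pos_var yP yA \<alpha> \<beta>) (pos_loss yP yA \<alpha> \<beta>)"
    "pos_mean yP yA \<alpha> \<beta> \<beta> = yP \<beta>" "pos_var yP yA \<alpha> \<beta> \<beta> = pos_loss yP yA \<alpha> \<beta>"
proof -
  obtain zP' zA' where "biased_interval yP yA zP' zA' \<alpha> \<beta>"
    using biased_intervalI[OF \<alpha>\<beta> C1 mono] .
  then interpret decreasing_bias yP yA zP' zA' \<alpha> \<beta>
    using assms by (simp add: decreasing_bias_def decreasing_bias_axioms_def)
  show "minimax_on yP yA \<alpha> \<beta> (pos_mean yP yA \<alpha> \<beta>) (pos_var yP yA \<alpha> \<beta>) (pos_loss yP yA \<alpha> \<beta>)"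
    "pos_mean yP yA \<alpha> \<beta> \<beta> = yP \<beta>" "pos_var yP yA \<alpha> \<beta> \<beta> = pos_loss yP yA \<alpha> \<beta>"
    by (fact minimax_dec endpoint_dec)+
qed

abbreviation "reg_minimax \<equiv>
  minimax_on yP yA \<alpha> \<beta> (reg_mean yP yA \<alpha> \<beta>) (reg_var yP yA \<alpha> \<beta>) (reg_loss yP yA \<alpha> \<beta>)"

lemma increasing_right:
  assumes "mono_on {\<alpha>..\<beta>} (\<lambda>t. yA t - yP t)" "yA \<alpha> = yP \<alpha>" "\<And>t. t \<in> {\<alpha><..\<beta>} \<Longrightarrow> yP t < yA t"
  shows reg_minimax "reg_mean yP yA \<alpha> \<beta> \<alpha> = yA \<alpha>" "reg_var yP yA \<alpha> \<beta> \<alpha> = 0"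
proof -
  have "0 \<le> yA t - yP t" if "t \<in> {\<alpha>..\<beta>}" for t
    using assms(2) assms(3)[of t] that by (cases "t = \<alpha>") auto
  then have "nonneg_bias yP yA \<alpha> \<beta>" by (simp add: nonneg_bias_def)
  note r = reg_pos[OF this]
  show reg_minimax "reg_mean yP yA \<alpha> \<beta> \<alpha> = yA \<alpha>" "reg_var yP yA \<alpha> \<beta> \<alpha> = 0"
    unfolding r by (rule minimax_increasing_pos[OF assms]; assumption)+
qed

lemma decreasing_left:
  assumes "antimono_on {\<alpha>..\<beta>} (\<lambda>t. yA t - yP t)" "yA \<beta> = yP \<beta>" "\<And>t. t \<in> {\<alpha>..<\<beta>} \<Longrightarrow> yP t < yA t"
  shows reg_minimax "reg_mean yP yA \<alpha> \<beta> \<beta> = yP \<beta>" "reg_var yP yA \<alpha> \<beta> \<beta> = reg_loss yP yA \<alpha> \<beta>"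
proof -
  have "0 \<le> yA t - yP t" if "t \<in> {\<alpha>..\<beta>}" for t
    using assms(2) assms(3)[of t] that by (cases "t = \<beta>") auto
  then have "nonneg_bias yP yA \<alpha> \<beta>" by (simp add: nonneg_bias_def)
  note r = reg_pos[OF this]
  show reg_minimax "reg_mean yP yA \<alpha> \<beta> \<beta> = yP \<beta>" "reg_var yP yA \<alpha> \<beta> \<beta> = reg_loss yP yA \<alpha> \<beta>"
    unfolding r by (rule minimax_decreasing_pos[OF assms]; assumption)+
qed

text \<open>Reflection turns a nonpositive increasing bias vanishing at the right end into a
  nonnegative increasing one vanishing at the left end, so the positive-bias case applies.\<close>

lemma increasing_left:
  assumes "mono_on {\<alpha>..\<beta>} (\<lambda>t. yA t - yP t)" "yA \<beta> = yP \<beta>" "\<And>t. t \<in> {\<alpha>..<\<beta>} \<Longrightarrow> yA t < yP t"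
  shows reg_minimax "reg_mean yP yA \<alpha> \<beta> \<beta> = yA \<beta>" "reg_var yP yA \<alpha> \<beta> \<beta> = 0"
proof -
  have "\<not> nonneg_bias yP yA \<alpha> \<beta>" using assms(3)[of \<alpha>] \<alpha>\<beta> by (auto simp: nonneg_bias_def intro!: bexI[of _ \<alpha>])
  note r = reg_neg[OF this]
  interpret R: regional_problem rP rA \<alpha> \<beta> by (rule reflected)
  have r1: "mono_on {\<alpha>..\<beta>} (\<lambda>t. rA t - rP t)"
  proof (rule monotone_onI)
    fix u v assume "u \<in> {\<alpha>..\<beta>}" "v \<in> {\<alpha>..\<beta>}" "u \<le> v"
    then show "rA u - rP u \<le> rA v - rP v"
      using monotone_onD[OF assms(1), of "\<alpha> + \<beta> - v" "\<alpha> + \<beta> - u"] by (simp add: reflect_def)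
  qed
  have r2: "rA \<alpha> = rP \<alpha>" using assms(2) by (simp add: reflect_def)
  have r3: "rP t < rA t" if "t \<in> {\<alpha><..\<beta>}" for t
    using assms(3)[of "\<alpha> + \<beta> - t"] that by (simp add: reflect_def)
  note m = R.minimax_increasing_pos[OF r1 r2 r3]
  show reg_minimax unfolding r by (rule minimax_on_reflect[OF m(1)])
  show "reg_mean yP yA \<alpha> \<beta> \<beta> = yA \<beta>" unfolding r using m(2) by (simp add: reflect_def)
  show "reg_var yP yA \<alpha> \<beta> \<beta> = 0" unfolding r using m(3) by simp
qed

lemma decreasing_right:
  assumes "antimono_on {\<alpha>..\<beta>} (\<lambda>t. yA t - yP t)" "yA \<alpha> = yP \<alpha>" "\<And>t. t \<in> {\<alpha><..\<beta>} \<Longrightarrow> yA t < yP t"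
  shows reg_minimax "reg_mean yP yA \<alpha> \<beta> \<alpha> = yP \<alpha>" "reg_var yP yA \<alpha> \<beta> \<alpha> = reg_loss yP yA \<alpha> \<beta>"
proof -
  have "\<not> nonneg_bias yP yA \<alpha> \<beta>" using assms(3)[of \<beta>] \<alpha>\<beta> by (auto simp: nonneg_bias_def intro!: bexI[of _ \<beta>])
  note r = reg_neg[OF this]
  interpret R: regional_problem rP rA \<alpha> \<beta> by (rule reflected)
  have r1: "antimono_on {\<alpha>..\<beta>} (\<lambda>t. rA t - rP t)"
  proof (rule monotone_onI)
    fix u v assume "u \<in> {\<alpha>..\<beta>}" "v \<in> {\<alpha>..\<beta>}" "u \<le> v"
    then show "rA v - rP v \<le> rA u - rP u"
      using monotone_onD[OF assms(1), of "\<alpha> + \<beta> - v" "\<alpha> + \<beta> - u"] by (simp add: reflect_def)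
  qed
  have r2: "rA \<beta> = rP \<beta>" using assms(2) by (simp add: reflect_def)
  have r3: "rP t < rA t" if "t \<in> {\<alpha>..<\<beta>}" for t
    using assms(3)[of "\<alpha> + \<beta> - t"] that by (simp add: reflect_def)
  note m = R.minimax_decreasing_pos[OF r1 r2 r3]
  show reg_minimax unfolding r by (rule minimax_on_reflect[OF m(1)])
  show "reg_mean yP yA \<alpha> \<beta> \<alpha> = yP \<alpha>" unfolding r using m(2) by (simp add: reflect_def)
  show "reg_var yP yA \<alpha> \<beta> \<alpha> = reg_loss yP yA \<alpha> \<beta>" unfolding r using m(3) by simp
qed

end

text \<open>A constant added to a variance does not affect incentives within a region, so
  \<open>k1\<close> and \<open>k2\<close> are free to make the variances agree at \<open>b\<close>,
  within the room left by the larger loss. No competitor beats that loss, since its restriction to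
  either region is a regional competitor.\<close>

lemma minimax_on_glue:
  assumes m1: "minimax_on yP yA a b \<mu>1 \<tau>1 w1" and m2: "minimax_on yP yA b c \<mu>2 \<tau>2 w2"
    and y: "strict_mono_on {a..c} yA" and ab: "a \<le> b" "b \<le> c"
    and k: "w1 + k1 \<le> max w1 w2" "w2 + k2 \<le> max w1 w2"
    and eq: "\<mu>1 b = \<mu>2 b" "\<tau>1 b + k1 = \<tau>2 b + k2"
    and \<mu>: "\<And>\<theta>. \<mu> \<theta> = (if \<theta> \<le> b then \<mu>1 \<theta> else \<mu>2 \<theta>)"
    and \<tau>: "\<And>\<theta>. \<tau> \<theta> = (if \<theta> \<le> b then \<tau>1 \<theta> + k1 else \<tau>2 \<theta> + k2)"
  shows "minimax_on yP yA a c \<mu> \<tau> (max w1 w2)"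
  unfolding minimax_on_def
proof (intro conjI ballI allI impI)
  note d1 = m1[unfolded minimax_on_def] and d2 = m2[unfolded minimax_on_def]
  have e1: "\<mu> \<theta> = \<mu>1 \<theta>" "\<tau> \<theta> = \<tau>1 \<theta> + k1" if "\<theta> \<in> {a..b}" for \<theta> using that \<mu> \<tau> by auto
  have e2: "\<mu> \<theta> = \<mu>2 \<theta>" "\<tau> \<theta> = \<tau>2 \<theta> + k2" if "\<theta> \<in> {b..c}" for \<theta>
    using that \<mu>[of \<theta>] \<tau>[of \<theta>] eq by (cases "\<theta> = b"; auto)+
  have "ic_on yA \<mu>1 (\<lambda>\<theta>. \<tau>1 \<theta> + k1) {a..b}" "ic_on yA \<mu>2 (\<lambda>\<theta>. \<tau>2 \<theta> + k2) {b..c}"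
    using d1 d2 by (simp_all add: ic_on_add_const)
  then have "ic_on yA \<mu> \<tau> {a..b}" "ic_on yA \<mu> \<tau> {b..c}"
    using ic_on_cong[of "{a..b}", OF e1] ic_on_cong[of "{b..c}", OF e2] by simp_all
  then show "ic_on yA \<mu> \<tau> {a..c}" by (rule ic_on_glue[OF _ _ y ab])
  fix \<theta> assume \<theta>: "\<theta> \<in> {a..c}"
  show "\<tau> \<theta> + (\<mu> \<theta> - yP \<theta>)\<^sup>2 \<le> max w1 w2"
  proof (cases "\<theta> \<le> b")
    case True
    then have "\<theta> \<in> {a..b}" using \<theta> by auto
    moreover from this have "\<tau>1 \<theta> + (\<mu>1 \<theta> - yP \<theta>)\<^sup>2 \<le> w1" using d1 by blast
    ultimately show ?thesis using k e1 by force
  next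
    case False
    then have "\<theta> \<in> {b..c}" using \<theta> by auto
    moreover from this have "\<tau>2 \<theta> + (\<mu>2 \<theta> - yP \<theta>)\<^sup>2 \<le> w2" using d2 by blast
    ultimately show ?thesis using k e2 by force
  qed
next
  fix \<mu>' \<tau>' B K
  assume ic: "ic_on yA \<mu>' \<tau>' {a..c}" and B: "\<forall>\<theta>\<in>{a..c}. \<bar>\<mu>' \<theta>\<bar> \<le> B \<and> 0 \<le> \<tau>' \<theta>"
    and K: "\<forall>\<theta>\<in>{a..c}. \<tau>' \<theta> + (\<mu>' \<theta> - yP \<theta>)\<^sup>2 \<le> K"
  have sub: "{a..b} \<subseteq> {a..c}" "{b..c} \<subseteq> {a..c}" using ab by auto
  have "w1 \<le> K"
    by (rule m1[unfolded minimax_on_def, THEN conjunct2, THEN conjunct2, rule_format,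
          OF ic_on_subset[OF ic sub(1)]]) (use B K sub in blast)+
  moreover have "w2 \<le> K"
    by (rule m2[unfolded minimax_on_def, THEN conjunct2, THEN conjunct2, rule_format,
          OF ic_on_subset[OF ic sub(2)]]) (use B K sub in blast)+
  ultimately show "max w1 w2 \<le> K" by simp
qed

lemma star_minimax:
  fixes x :: real
  assumes C1: "C1_on_Icc 0 1 yP" "C1_on_Icc 0 1 yA"
    and mono: "strict_mono_on Types yP" "strict_mono_on Types yA"
    and bias: "mono_on Types (\<lambda>\<theta>. yA \<theta> - yP \<theta>) \<or> antimono_on Types (\<lambda>\<theta>. yA \<theta> - yP \<theta>)"
    and zero: "\<And>\<theta>. \<theta> \<in> Types \<Longrightarrow> yA \<theta> = yP \<theta> \<Longrightarrow> \<theta> = x"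
    and x: "0 < x" "x < 1" "yA x = yP x"
  obtains w where "minimax_on yP yA 0 1 (star_mean yP yA x) (star_var yP yA x) w"
proof -
  have sub: "{0..x} \<subseteq> Types" "{x..1} \<subseteq> Types" using x by auto
  interpret L: regional_problem yP yA 0 x
    using x C1_on_Icc_subset[OF C1(1)] C1_on_Icc_subset[OF C1(2)]
      monotone_on_subset[OF mono(1) sub(1)] monotone_on_subset[OF mono(2) sub(1)]
    by unfold_locales auto
  interpret R: regional_problem yP yA x 1
    using x C1_on_Icc_subset[OF C1(1)] C1_on_Icc_subset[OF C1(2)]
      monotone_on_subset[OF mono(1) sub(2)] monotone_on_subset[OF mono(2) sub(2)]
    by unfold_locales auto
  show thesis
  proof (cases "mono_on Types (\<lambda>\<theta>. yA \<theta> - yP \<theta>)")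
    case True
    have l: "yA t < yP t" if "t \<in> {0..<x}" for t
      using monotone_onD[OF True, of t x] zero[of t] that x by force
    have r: "yP t < yA t" if "t \<in> {x<..1}" for t
      using monotone_onD[OF True, of x t] zero[of t] that x by force
    note ml = L.increasing_left[OF monotone_on_subset[OF True sub(1)] x(3) l]
    note mr = R.increasing_right[OF monotone_on_subset[OF True sub(2)] x(3) r]
    have "minimax_on yP yA 0 1 (star_mean yP yA x) (star_var yP yA x)
        (max (reg_loss yP yA 0 x) (reg_loss yP yA x 1))"
      by (rule minimax_on_glue[OF ml(1) mr(1) mono(2), where ?k1.0 = 0 and ?k2.0 = 0])
        (use x ml mr True in \<open>auto simp: star_mean_def star_var_def star_var_inc_def\<close>)
    then show thesis by (rule that)
  next
    case False
    then have anti: "antimono_on Types (\<lambda>\<theta>. yA \<theta> - yP \<theta>)" using bias by blast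
    have l: "yP t < yA t" if "t \<in> {0..<x}" for t
      using monotone_onD[OF anti, of t x] zero[of t] that x by force
    have r: "yA t < yP t" if "t \<in> {x<..1}" for t
      using monotone_onD[OF anti, of x t] zero[of t] that x by force
    note ml = L.decreasing_left[OF monotone_on_subset[OF anti sub(1)] x(3) l]
    note mr = R.decreasing_right[OF monotone_on_subset[OF anti sub(2)] x(3) r]
    let ?w1 = "reg_loss yP yA 0 x" and ?w2 = "reg_loss yP yA x 1"
    have "minimax_on yP yA 0 1 (star_mean yP yA x) (star_var yP yA x) (max ?w1 ?w2)"
      by (rule minimax_on_glue[OF ml(1) mr(1) mono(2),
            where ?k1.0 = "max ?w1 ?w2 - ?w1" and ?k2.0 = "max ?w1 ?w2 - ?w2"])
        (use x ml mr False in \<open>auto simp: star_mean_def star_var_def star_var_dec_def Let_def\<close>)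
    then show thesis by (rule that)
  qed
qed

section \<open>Mechanisms as kernels\<close>

lemma
  assumes m: "m \<in> kernels {a\<^sub>0..b\<^sub>0}" and r: "r \<in> Types"
  shows kernel_prob_space: "prob_space (m r)"
    and kernel_integrable: "integrable (m r) (\<lambda>a. a)" "integrable (m r) (\<lambda>a. a\<^sup>2)"
    and kernel_mean: "mech_mean m r \<in> {a\<^sub>0..b\<^sub>0}"
    and kernel_var: "0 \<le> mech_var m r"
    and kernel_payoff: "payoff y m \<theta> r = - (mech_var m r + (mech_mean m r - y \<theta>)\<^sup>2)"
proof -
  have "m r \<in> space (prob_algebra (restrict_space borel {a\<^sub>0..b\<^sub>0}))"
    using measurable_space[OF m[unfolded kernels_def], of r] r by (simp add: space_restrict_space)
  then have sets: "sets (m r) = sets (restrict_space borel {a\<^sub>0..b\<^sub>0})" and P: "prob_space (m r)"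
    by (auto simp: space_prob_algebra)
  interpret prob_space "m r" by (rule P)
  show "prob_space (m r)" by (rule P)
  have space: "space (m r) = {a\<^sub>0..b\<^sub>0}"
    using sets_eq_imp_space_eq[OF sets] by (simp add: space_restrict_space)
  have meas: "f \<in> borel_measurable (m r)" if "f \<in> borel_measurable borel" for f :: "real \<Rightarrow> real"
    using measurable_restrict_space1[OF that] measurable_cong_sets[OF sets refl] by blast
  have bound: "\<bar>a\<bar> \<le> \<bar>a\<^sub>0\<bar> + \<bar>b\<^sub>0\<bar>" if "a \<in> space (m r)" for a using that space by auto
  show i1: "integrable (m r) (\<lambda>a. a)"
    by (rule integrable_const_bound[where B="\<bar>a\<^sub>0\<bar> + \<bar>b\<^sub>0\<bar>"]) (auto intro!: AE_I2 bound meas)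
  show i2: "integrable (m r) (\<lambda>a. a\<^sup>2)"
  proof (rule integrable_const_bound[where B="(\<bar>a\<^sub>0\<bar> + \<bar>b\<^sub>0\<bar>)\<^sup>2"])
    show "AE a in m r. norm (a\<^sup>2) \<le> (\<bar>a\<^sub>0\<bar> + \<bar>b\<^sub>0\<bar>)\<^sup>2"
      using power_mono[OF bound, of _ 2] by (intro AE_I2) auto
  qed (auto intro!: meas)
  have sq: "(LINT a|m r. (a - k)\<^sup>2) = (LINT a|m r. a\<^sup>2) - 2 * k * (LINT a|m r. a) + k\<^sup>2" for k
  proof -
    have "(LINT a|m r. (a - k)\<^sup>2) = (LINT a|m r. a\<^sup>2 - 2 * k * a + k\<^sup>2)"
      by (simp add: power2_eq_square algebra_simps)
    also have "\<dots> = (LINT a|m r. a\<^sup>2) - 2 * k * (LINT a|m r. a) + k\<^sup>2"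
      using i1 i2 by (simp add: prob_space)
    finally show ?thesis .
  qed
  show "payoff y m \<theta> r = - (mech_var m r + (mech_mean m r - y \<theta>)\<^sup>2)"
    unfolding payoff_def mech_var_def sq by (simp add: mech_mean_def power2_eq_square algebra_simps)
  show "0 \<le> mech_var m r" unfolding mech_var_def by simp
  have "a\<^sub>0 \<le> mech_mean m r" unfolding mech_mean_def
    by (rule integral_ge_const[OF i1]) (auto intro!: AE_I2 simp: space)
  moreover have "mech_mean m r \<le> b\<^sub>0" unfolding mech_mean_def
    by (rule integral_le_const[OF i1]) (auto intro!: AE_I2 simp: space)
  ultimately show "mech_mean m r \<in> {a\<^sub>0..b\<^sub>0}" by simp
qed

text \<open>Type and report coincide, so both the measure and the integrand vary with \<theta>.
  Expanding the square leaves the first two moments of the kernel, which are measurable, and the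
  continuous \<open>y\<close>.\<close>

lemma payoff_measurable:
  assumes m: "m \<in> kernels {a\<^sub>0..b\<^sub>0}" and y: "continuous_on Types y"
  shows "(\<lambda>\<theta>. payoff y m \<theta> \<theta>) \<in> borel_measurable (restrict_space borel Types)"
proof -
  let ?A = "restrict_space borel {a\<^sub>0..b\<^sub>0}"
  have m': "m \<in> restrict_space borel Types \<rightarrow>\<^sub>M subprob_algebra ?A"
    using m unfolding kernels_def by (rule measurable_prob_algebraD)
  have int: "(\<lambda>\<theta>. LINT a|m \<theta>. f a) \<in> borel_measurable (restrict_space borel Types)"
    if "f \<in> borel_measurable borel" for f :: "real \<Rightarrow> real"
    by (rule measurable_compose[OF m' integral_measurable_subprob_algebra])
      (rule measurable_restrict_space1[OF that])
  have [measurable]: "(\<lambda>\<theta>. LINT a|m \<theta>. a) \<in> borel_measurable (restrict_space borel Types)"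
    "(\<lambda>\<theta>. LINT a|m \<theta>. a\<^sup>2) \<in> borel_measurable (restrict_space borel Types)"
    by (rule int; measurable)+
  have [measurable]: "y \<in> borel_measurable (restrict_space borel Types)"
    by (rule borel_measurable_continuous_on_restrict[OF y])
  have "payoff y m \<theta> \<theta> = - ((LINT a|m \<theta>. a\<^sup>2) - 2 * y \<theta> * (LINT a|m \<theta>. a) + (y \<theta>)\<^sup>2)"
    if "\<theta> \<in> Types" for \<theta>
  proof -
    interpret prob_space "m \<theta>" by (rule kernel_prob_space[OF m that])
    have "(LINT a|m \<theta>. (a - y \<theta>)\<^sup>2) = (LINT a|m \<theta>. a\<^sup>2 - 2 * y \<theta> * a + (y \<theta>)\<^sup>2)"
      by (simp add: power2_eq_square algebra_simps)
    then show ?thesis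
      using kernel_integrable[OF m that] by (simp add: payoff_def prob_space)
  qed
  then show ?thesis
    by (subst measurable_cong[where g = "\<lambda>\<theta>. - ((LINT a|m \<theta>. a\<^sup>2) - 2 * y \<theta> * (LINT a|m \<theta>. a) + (y \<theta>)\<^sup>2)"])
      (auto simp: space_restrict_space)
qed

section \<open>Worst case over type distributions\<close>

lemma interval_measure_cdf:
  assumes "real_distribution \<nu>"
  shows "interval_measure (cdf \<nu>) = \<nu>"
proof -
  interpret real_distribution \<nu> by fact
  show ?thesis
    by (intro cdf_unique real_distribution_interval_measure cdf_interval_measure assms
        cdf_nondecreasing cdf_is_right_cont cdf_lim_at_bot cdf_lim_at_top_prob)
qed

lemma mech_value_ge:
  assumes K: "\<And>\<theta>. \<theta> \<in> Types \<Longrightarrow> - K \<le> payoff y m \<theta> \<theta>" "0 \<le> K" and F: "F \<in> type_CDFs"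
  shows "- K \<le> mech_value y m F"
proof -
  obtain \<nu> where \<nu>: "F = cdf \<nu>" "real_distribution \<nu>" "measure \<nu> Types = 1"
    using F by (auto simp: type_CDFs_def)
  interpret real_distribution \<nu> by (rule \<nu>)
  have v: "mech_value y m F = (LINT \<theta>:Types|\<nu>. payoff y m \<theta> \<theta>)"
    by (simp add: mech_value_def \<nu>(1) interval_measure_cdf[OF \<nu>(2)])
  show ?thesis
  proof (cases "set_integrable \<nu> Types (\<lambda>\<theta>. payoff y m \<theta> \<theta>)")
    case True
    have "(LINT \<theta>:Types|\<nu>. - K) \<le> (LINT \<theta>:Types|\<nu>. payoff y m \<theta> \<theta>)"
    proof (rule set_integral_mono[OF _ True])
      have "integrable \<nu> (indicator Types :: real \<Rightarrow> real)"
        by (rule integrable_real_indicator) (auto simp: emeasure_eq_measure)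
      then show "set_integrable \<nu> Types (\<lambda>_. - K)" by (simp add: set_integrable_def)
    qed (rule K)
    then show ?thesis using \<nu>(3) by (simp add: v set_lebesgue_integral_def)
  next
    \<comment> \<open>A non-integrable payoff has integral 0 by convention; \<open>0 \<le> K\<close>
      covers this case.\<close>
    case False
    then have "mech_value y m F = 0"
      unfolding v set_lebesgue_integral_def set_integrable_def by (rule not_integrable_integral_eq)
    then show ?thesis using K(2) by simp
  qed
qed

lemma mech_value_point_mass:
  assumes m: "m \<in> kernels {a\<^sub>0..b\<^sub>0}" and y: "continuous_on Types y" and \<theta>: "\<theta> \<in> Types"
  obtains F where "F \<in> type_CDFs" "mech_value y m F = payoff y m \<theta> \<theta>"
proof -
  let ?\<nu> = "return borel \<theta>"
  interpret prob_space ?\<nu> by (rule prob_space_return) simp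
  have rd: "real_distribution ?\<nu>" by unfold_locales auto
  have "(\<lambda>\<theta>. indicator Types \<theta> *\<^sub>R payoff y m \<theta> \<theta>) \<in> borel_measurable borel"
    using payoff_measurable[OF m y] by (subst borel_measurable_restrict_space_iff[symmetric]) auto
  then have "mech_value y m (cdf ?\<nu>) = payoff y m \<theta> \<theta>"
    using \<theta> by (simp add: mech_value_def interval_measure_cdf[OF rd] set_lebesgue_integral_def integral_return)
  moreover have "cdf ?\<nu> \<in> type_CDFs"
    using rd \<theta> by (auto simp: type_CDFs_def measure_return)
  ultimately show thesis by (rule that[rotated])
qed

lemma IC_mechanisms_iff:
  assumes "m \<in> kernels {a\<^sub>0..b\<^sub>0}"
  shows "m \<in> IC_mechanisms {a\<^sub>0..b\<^sub>0} y \<longleftrightarrow> ic_on y (mech_mean m) (mech_var m) Types"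
  using assms
  by (auto simp: IC_mechanisms_def ic_on_def kernel_payoff[OF assms] simp del: minus_add_distrib)

lemma robustly_optimalI:
  assumes mm: "minimax_on yP yA 0 1 (mech_mean m) (mech_var m) w"
    and m: "m \<in> kernels {a\<^sub>0..b\<^sub>0}" and yP: "yP \<in> Types \<rightarrow> {a\<^sub>0..b\<^sub>0}" "continuous_on Types yP"
  shows "robustly_optimal {a\<^sub>0..b\<^sub>0} yP yA m"
proof -
  note d = mm[unfolded minimax_on_def]
  let ?I = "\<lambda>m. INF F\<in>type_CDFs. mech_value yP m F"
  have mIC: "m \<in> IC_mechanisms {a\<^sub>0..b\<^sub>0} yA" using d IC_mechanisms_iff[OF m] by blast
  have loss: "mech_var m \<theta> + (mech_mean m \<theta> - yP \<theta>)\<^sup>2 \<le> w" if "\<theta> \<in> Types" for \<theta>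
    using d that by blast
  have w: "0 \<le> w"
    using loss[of 0] kernel_var[OF m, of 0] by (simp add: add_nonneg_nonneg order_trans[rotated])
  have ne: "type_CDFs \<noteq> {}"
    by (rule mech_value_point_mass[OF m yP(2), of 0]) auto
  have low: "- w \<le> ?I m"
    by (rule cINF_greatest[OF ne], rule mech_value_ge) (use loss w in \<open>auto simp: kernel_payoff[OF m] simp del: minus_add_distrib\<close>)
  have up: "?I m' \<le> - w" if m': "m' \<in> IC_mechanisms {a\<^sub>0..b\<^sub>0} yA" for m'
  proof -
    have k: "m' \<in> kernels {a\<^sub>0..b\<^sub>0}" using m' by (simp add: IC_mechanisms_def)
    \<comment> \<open>Without a lower bound the real infimum would carry no information. Actions and
      \<open>yP\<close> lie in the same interval, so its squared length bounds every loss.\<close>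
    have bdd: "bdd_below (mech_value yP m' ` type_CDFs)"
    proof (rule bdd_belowI2)
      fix F :: "real \<Rightarrow> real" assume F: "F \<in> type_CDFs"
      show "- ((b\<^sub>0 - a\<^sub>0)\<^sup>2) \<le> mech_value yP m' F"
      proof (rule mech_value_ge[OF _ _ F])
        fix \<theta> :: real assume \<theta>: "\<theta> \<in> Types"
        interpret prob_space "m' \<theta>" by (rule kernel_prob_space[OF k \<theta>])
        have sp: "space (m' \<theta>) = {a\<^sub>0..b\<^sub>0}"
          using measurable_space[OF k[unfolded kernels_def], of \<theta>] \<theta>
          by (auto simp: space_restrict_space space_prob_algebra dest: sets_eq_imp_space_eq)
        have "(LINT a|m' \<theta>. (a - yP \<theta>)\<^sup>2) \<le> (b\<^sub>0 - a\<^sub>0)\<^sup>2"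
        proof (rule integral_le_const)
          show "integrable (m' \<theta>) (\<lambda>a. (a - yP \<theta>)\<^sup>2)"
            using kernel_integrable[OF k \<theta>] by (simp add: power2_diff)
          have "(a - yP \<theta>)\<^sup>2 \<le> (b\<^sub>0 - a\<^sub>0)\<^sup>2" if "a \<in> {a\<^sub>0..b\<^sub>0}" for a
          proof -
            have "a\<^sub>0 \<le> yP \<theta>" "yP \<theta> \<le> b\<^sub>0" using yP(1) \<theta> by auto
            then have "\<bar>a - yP \<theta>\<bar> \<le> \<bar>b\<^sub>0 - a\<^sub>0\<bar>" using that by auto
            then show ?thesis by (simp only: abs_le_square_iff)
          qed
          then show "AE a in m' \<theta>. (a - yP \<theta>)\<^sup>2 \<le> (b\<^sub>0 - a\<^sub>0)\<^sup>2" by (intro AE_I2) (simp add: sp)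
        qed
        then show "- ((b\<^sub>0 - a\<^sub>0)\<^sup>2) \<le> payoff yP m' \<theta> \<theta>" by (simp add: payoff_def)
      qed simp
    qed
    \<comment> \<open>The regional lower bound is applied with \<open>K\<close> equal to the negated
      guarantee of \<open>m'\<close>; point masses show that no type's loss exceeds it.\<close>
    have "w \<le> - ?I m'"
    proof (rule mm[unfolded minimax_on_def, THEN conjunct2, THEN conjunct2, rule_format])
      show "ic_on yA (mech_mean m') (mech_var m') Types" using IC_mechanisms_iff[OF k] m' by simp
      show "\<bar>mech_mean m' \<theta>\<bar> \<le> \<bar>a\<^sub>0\<bar> + \<bar>b\<^sub>0\<bar> \<and> 0 \<le> mech_var m' \<theta>" if "\<theta> \<in> Types" for \<theta>
        using kernel_mean[OF k that] kernel_var[OF k that] by auto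
      show "mech_var m' \<theta> + (mech_mean m' \<theta> - yP \<theta>)\<^sup>2 \<le> - ?I m'" if \<theta>: "\<theta> \<in> Types" for \<theta>
      proof -
        obtain F where F: "F \<in> type_CDFs" "mech_value yP m' F = payoff yP m' \<theta> \<theta>"
          using mech_value_point_mass[OF k yP(2) \<theta>] .
        have "?I m' \<le> mech_value yP m' F" by (rule cINF_lower[OF bdd F(1)])
        then show ?thesis unfolding F(2) kernel_payoff[OF k \<theta>] by simp
      qed
    qed
    then show ?thesis by simp
  qed
  have "?I m \<le> (SUP m'\<in>IC_mechanisms {a\<^sub>0..b\<^sub>0} yA. ?I m')"
    by (rule cSUP_upper[OF mIC]) (auto intro!: bdd_aboveI2 up)
  moreover have "(SUP m'\<in>IC_mechanisms {a\<^sub>0..b\<^sub>0} yA. ?I m') \<le> - w"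
    by (rule cSUP_least) (use mIC up in auto)
  ultimately show ?thesis unfolding robustly_optimal_def using mIC low by simp
qed

theorem theorem2:
  fixes y\<^sub>P y\<^sub>A :: "real \<Rightarrow> real"
    and a\<^sub>0 b\<^sub>0 \<theta>\<^sub>x :: real
    and m :: "real \<Rightarrow> real measure"
  assumes y_range: "y\<^sub>P \<in> Types \<rightarrow> {a\<^sub>0..b\<^sub>0}" "y\<^sub>A \<in> Types \<rightarrow> {a\<^sub>0..b\<^sub>0}"
    and y_C1: "C1_on_Icc 0 1 y\<^sub>P" "C1_on_Icc 0 1 y\<^sub>A"
    and y_mono: "strict_mono_on Types y\<^sub>P" "strict_mono_on Types y\<^sub>A"
    and bias: "mono_on Types (\<lambda>\<theta>. y\<^sub>A \<theta> - y\<^sub>P \<theta>) \<or> antimono_on Types (\<lambda>\<theta>. y\<^sub>A \<theta> - y\<^sub>P \<theta>)"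
    and one_zero: "\<And>\<theta> \<theta>'. \<lbrakk>\<theta> \<in> Types; \<theta>' \<in> Types; y\<^sub>A \<theta> - y\<^sub>P \<theta> = 0; y\<^sub>A \<theta>' - y\<^sub>P \<theta>' = 0\<rbrakk> \<Longrightarrow> \<theta> = \<theta>'"
    and crossing: "0 < \<theta>\<^sub>x" "\<theta>\<^sub>x < 1" "y\<^sub>A \<theta>\<^sub>x = y\<^sub>P \<theta>\<^sub>x"
    and large: "\<And>\<theta>. \<theta> \<in> Types \<Longrightarrow>
      star_var y\<^sub>P y\<^sub>A \<theta>\<^sub>x \<theta> \<le> (star_mean y\<^sub>P y\<^sub>A \<theta>\<^sub>x \<theta> - a\<^sub>0) * (b\<^sub>0 - star_mean y\<^sub>P y\<^sub>A \<theta>\<^sub>x \<theta>)"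
    and kernel: "m \<in> kernels {a\<^sub>0..b\<^sub>0}"
    and mean: "\<And>\<theta>. \<theta> \<in> Types \<Longrightarrow> mech_mean m \<theta> = star_mean y\<^sub>P y\<^sub>A \<theta>\<^sub>x \<theta>"
    and var: "\<And>\<theta>. \<theta> \<in> Types \<Longrightarrow> mech_var m \<theta> = star_var y\<^sub>P y\<^sub>A \<theta>\<^sub>x \<theta>"
  shows "robustly_optimal {a\<^sub>0..b\<^sub>0} y\<^sub>P y\<^sub>A m"
proof -
  have zero: "\<theta> = \<theta>\<^sub>x" if "\<theta> \<in> Types" "y\<^sub>A \<theta> = y\<^sub>P \<theta>" for \<theta>
    using one_zero[of \<theta> \<theta>\<^sub>x] that crossing by simp
  obtain w where "minimax_on y\<^sub>P y\<^sub>A 0 1 (star_mean y\<^sub>P y\<^sub>A \<theta>\<^sub>x) (star_var y\<^sub>P y\<^sub>A \<theta>\<^sub>x) w"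
    using star_minimax[OF y_C1 y_mono bias zero crossing] .
  then have "minimax_on y\<^sub>P y\<^sub>A 0 1 (mech_mean m) (mech_var m) w"
    unfolding minimax_on_def using ic_on_cong[of Types, OF mean var] mean var by simp
  moreover have "continuous_on Types y\<^sub>P"
    using y_C1(1) by (auto simp: C1_on_Icc_def intro: DERIV_continuous_on)
  ultimately show ?thesis
    using kernel y_range(1) by (intro robustly_optimalI)
qed

end
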